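(* Fix $k\in\mathbb{N}$ and let $\mathfrak{X}_{k+1}$ be the completion of $c_{00}([\mathbb{N}]^{k+1})$ under the norm $\|x\|=\sup(\sum_{i=1}^n\|\mathcal{P}_i(x)\|_1^2)^{1/2}$, the supremum taken over all $n$ and all finite sequences $(\mathcal{P}_i)_{i=1}^n$ of pairwise disjoint Schreier plegmatic families in $[\mathbb{N}]^{k+1}$, where $\|\mathcal{P}(x)\|_1=\sum_{s\in\mathcal{P}}|x(s)|$. Let $(e_s)_{s\in[\mathbb{N}]^{k+1}}$ be the natural Hamel basis. Then: (a) $(e_s)_{s\in[\mathbb{N}]^{k+1}}$ (in any enumeration compatible with unconditionality) is an unconditional basis of $\mathfrak{X}_{k+1}$, and the $(k+1)$-sequence $(e_s)_{s\in[\mathbb{N}]^{k+1}}$ generates a $(k+1)$-spreading model isometric to the usual basis of $\ell^1$; (b) $\mathfrak{X}_{k+1}$ is reflexive; (c) no element of $\mathcal{SM}_k(\mathfrak{X}_{k+1})$ is equivalent to the usual basis of $\ell^1$; (d) for no infinite $M\subseteq\mathbb{N}$ and no $x_0\in\mathfrak{X}_{k+1}$ is $(e_s)_{s\in[M]^{k+1}}$ $(k+1)$-Cesàro summable to $x_0$.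
   Context: $[M]^k$: $k$-subsets of $M\subseteq\mathbb{N}$, identified with increasing tuples; $M(l)$ is the $l$-th element of $M$ and $M|n=\{M(1),\dots,M(n)\}$. A family $\mathcal{P}\subseteq[\mathbb{N}]^{k+1}$ is plegmatic if there are finite sets $F_1<\dots<F_{k+1}$ ($\max F_i<\min F_{i+1}$) of equal cardinality with $\mathcal{P}\subseteq F_1\times\dots\times F_{k+1}$; it is Schreier plegmatic if moreover $|F_1|\le\min F_1$. Plegma family: $(s_j)_{j=1}^l$ in $[M]^k$ with $s_1(i)<\dots<s_l(i)$ ($i\le k$), $s_l(i)<s_1(i+1)$ ($i<k$). A $k$-sequence $(x_s)_{s\in[\mathbb{N}]^k}$ in a Banach space $Y$ generates the Hamel basis $(e_n)$ of a seminormed space $(E,\|\cdot\|_* )$ as a $k$-spreading model via infinite $M$ if for a null sequence $\delta_l>0$: $|\|\sum_{j=1}^m a_jx_{s_j}\|-\|\sum_{j=1}^m a_je_j\|_*|\le\delta_l$ for all $m\le l$, plegma $(s_j)_{j=1}^m$ in $[M]^k$ with $s_1(1)\ge M(l)$, $a_j\in[-1,1]$; $\mathcal{SM}_k(Y)$ is the set of all such sequences. $(x_s)_{s\in[M]^k}$ is $k$-Cesàro summable to $x_0$ if $\binom{n}{k}^{-1}\sum_{s\in[M|n]^k}x_s\to x_0$ in norm. *)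

theory Defs
  imports "HOL-Analysis.Analysis"
begin

definition NN :: "nat set" where "NN = {1..}"

definition ksubsets :: "nat set \<Rightarrow> nat \<Rightarrow> nat set set" where
  "ksubsets A k = {s. s \<subseteq> A \<and> finite s \<and> card s = k}"

text \<open>s(i): the i-th element (1-based) of a finite set s, in increasing order.\<close>
definition el :: "nat set \<Rightarrow> nat \<Rightarrow> nat" where
  "el s i = sorted_list_of_set s ! (i - 1)"

text \<open>M(l): the l-th element (1-based) of an infinite set M.\<close>
definition elM :: "nat set \<Rightarrow> nat \<Rightarrow> nat" where
  "elM M l = enumerate M (l - 1)"

definition restr :: "nat set \<Rightarrow> nat \<Rightarrow> nat set" where
  "restr M n = elM M ` {1..n}"

definition plegmatic_witness :: "nat \<Rightarrow> nat set set \<Rightarrow> (nat \<Rightarrow> nat set) \<Rightarrow> bool" where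
  "plegmatic_witness kk P F \<longleftrightarrow>
     (\<forall>i\<in>{1..kk}. finite (F i) \<and> F i \<noteq> {} \<and> card (F i) = card (F 1)) \<and>
     (\<forall>i\<in>{1..<kk}. \<forall>a\<in>F i. \<forall>b\<in>F (Suc i). a < b) \<and>
     P \<subseteq> {s \<in> ksubsets NN kk. \<forall>i\<in>{1..kk}. el s i \<in> F i}"

definition plegmatic :: "nat \<Rightarrow> nat set set \<Rightarrow> bool" where
  "plegmatic kk P \<longleftrightarrow> (\<exists>F. plegmatic_witness kk P F)"

definition schreier_plegmatic :: "nat \<Rightarrow> nat set set \<Rightarrow> bool" where
  "schreier_plegmatic kk P \<longleftrightarrow>
     (\<exists>F. plegmatic_witness kk P F \<and> card (F 1) \<le> Min (F 1))"

definition Xnorm :: "nat \<Rightarrow> (nat set \<Rightarrow> real) \<Rightarrow> real" where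
  "Xnorm kk x = Sup {sqrt (\<Sum>i=1..n. (\<Sum>s\<in>P i. \<bar>x s\<bar>)\<^sup>2) | (n::nat) (P::nat \<Rightarrow> nat set set).
        (\<forall>i\<in>{1..n}. schreier_plegmatic kk (P i)) \<and>
        (\<forall>i\<in>{1..n}. \<forall>i'\<in>{1..n}. i \<noteq> i' \<longrightarrow> P i \<inter> P i' = {})}"

definition c00 :: "nat \<Rightarrow> (nat set \<Rightarrow> real) set" where
  "c00 kk = {x. finite {s. x s \<noteq> 0} \<and> (\<forall>s. x s \<noteq> 0 \<longrightarrow> s \<in> ksubsets NN kk)}"

definition unitvec :: "nat set \<Rightarrow> nat set \<Rightarrow> real" where
  "unitvec s = (\<lambda>t. if t = s then 1 else 0)"

text \<open>j is an isometric linear embedding of (c00, Xnorm) with dense range,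
  i.e. the target is (a model of) the completion X_kk.\<close>
definition is_completion_map :: "nat \<Rightarrow> ((nat set \<Rightarrow> real) \<Rightarrow> 'a::banach) \<Rightarrow> bool" where
  "is_completion_map kk j \<longleftrightarrow>
     (\<forall>x\<in>c00 kk. \<forall>y\<in>c00 kk. j (\<lambda>t. x t + y t) = j x + j y) \<and>
     (\<forall>x\<in>c00 kk. \<forall>c. j (\<lambda>t. c * x t) = c *\<^sub>R j x) \<and>
     (\<forall>x\<in>c00 kk. norm (j x) = Xnorm kk x) \<and>
     closure (j ` c00 kk) = UNIV"

definition unconditional_basis :: "'i set \<Rightarrow> ('i \<Rightarrow> 'a::real_normed_vector) \<Rightarrow> bool" where
  "unconditional_basis I b \<longleftrightarrow>
     (\<forall>y. \<exists>a. ((\<lambda>i. a i *\<^sub>R b i) has_sum y) I) \<and>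
     (\<forall>y a a'. ((\<lambda>i. a i *\<^sub>R b i) has_sum y) I \<and> ((\<lambda>i. a' i *\<^sub>R b i) has_sum y) I
        \<longrightarrow> (\<forall>i\<in>I. a i = a' i))"

definition reflexive :: "'a::real_normed_vector itself \<Rightarrow> bool" where
  "reflexive _ \<longleftrightarrow>
     (\<forall>\<phi> :: ('a \<Rightarrow>\<^sub>L real) \<Rightarrow>\<^sub>L real. \<exists>x::'a. \<forall>f. blinfun_apply \<phi> f = blinfun_apply f x)"

definition plegma :: "nat \<Rightarrow> nat set \<Rightarrow> nat \<Rightarrow> (nat \<Rightarrow> nat set) \<Rightarrow> bool" where
  "plegma k M m s \<longleftrightarrow>
     (\<forall>j\<in>{1..m}. s j \<in> ksubsets M k) \<and>
     (\<forall>i\<in>{1..k}. \<forall>j\<in>{1..<m}. el (s j) i < el (s (Suc j)) i) \<and>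
     (\<forall>i\<in>{1..<k}. el (s m) i < el (s 1) (Suc i))"

text \<open>The k-sequence x generates, via the infinite set M, a k-spreading model whose
  norm satisfies ||sum_{j=1}^m a_j e_j||_* = N a m.\<close>
definition generates_sm :: "nat \<Rightarrow> (nat set \<Rightarrow> 'a::real_normed_vector) \<Rightarrow> nat set
      \<Rightarrow> ((nat \<Rightarrow> real) \<Rightarrow> nat \<Rightarrow> real) \<Rightarrow> bool" where
  "generates_sm k x M N \<longleftrightarrow> M \<subseteq> NN \<and> infinite M \<and>
     (\<exists>\<delta>::nat \<Rightarrow> real. (\<forall>l. \<delta> l > 0) \<and> \<delta> \<longlonglongrightarrow> 0 \<and>
       (\<forall>l m s a. 1 \<le> m \<and> m \<le> l \<and> plegma k M m s \<and> el (s 1) 1 \<ge> elM M l \<and>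
          (\<forall>j\<in>{1..m}. \<bar>a j\<bar> \<le> 1) \<longrightarrow>
          \<bar>norm (\<Sum>j=1..m. a j *\<^sub>R x (s j)) - N a m\<bar> \<le> \<delta> l))"

definition seminormed_hamel :: "('e::real_vector \<Rightarrow> real) \<Rightarrow> (nat \<Rightarrow> 'e) \<Rightarrow> bool" where
  "seminormed_hamel nrm e \<longleftrightarrow>
     (\<forall>v. nrm v \<ge> 0) \<and> (\<forall>c v. nrm (c *\<^sub>R v) = \<bar>c\<bar> * nrm v) \<and>
     (\<forall>v w. nrm (v + w) \<le> nrm v + nrm w) \<and>
     inj e \<and> independent (range e) \<and> span (range e) = UNIV"

definition k_spreading_model :: "nat \<Rightarrow> (nat set \<Rightarrow> 'a::real_normed_vector) \<Rightarrow> nat set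
      \<Rightarrow> ('e::real_vector \<Rightarrow> real) \<Rightarrow> (nat \<Rightarrow> 'e) \<Rightarrow> bool" where
  "k_spreading_model k x M nrm e \<longleftrightarrow>
     seminormed_hamel nrm e \<and> generates_sm k x M (\<lambda>a m. nrm (\<Sum>j=1..m. a j *\<^sub>R e j))"

definition equiv_l1_basis :: "('e::real_vector \<Rightarrow> real) \<Rightarrow> (nat \<Rightarrow> 'e) \<Rightarrow> bool" where
  "equiv_l1_basis nrm e \<longleftrightarrow> (\<exists>c C. 0 < c \<and> 0 < C \<and>
     (\<forall>m a. c * (\<Sum>j=1..m. \<bar>a j\<bar>) \<le> nrm (\<Sum>j=1..m. a j *\<^sub>R e j) \<and>
            nrm (\<Sum>j=1..m. a j *\<^sub>R e j) \<le> C * (\<Sum>j=1..m. \<bar>a j\<bar>)))"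

definition cesaro_summable :: "nat \<Rightarrow> (nat set \<Rightarrow> 'a::real_normed_vector) \<Rightarrow> nat set \<Rightarrow> 'a \<Rightarrow> bool" where
  "cesaro_summable k x M x0 \<longleftrightarrow>
     (\<lambda>n. (1 / real (n choose k)) *\<^sub>R (\<Sum>s\<in>ksubsets (restr M n) k. x s)) \<longlonglongrightarrow> x0"

end

theory Submission
  imports Defs "HOL-Library.Ramsey"
begin

text \<open>
  Disjointly supported vectors satisfy a lower 2-estimate with constant 1, because admissible families
  can be merged; this makes the basis boundedly complete. The heart of the matter is that a bounded
  \<open>k\<close>-sequence \<open>(x\<^sub>s)\<close> with \<open>k < kk\<close> admits no lower \<open>\<ell>\<^sup>1\<close> estimate on plegma families. By Ramsey's
  theorem and the lower 2-estimate one may assume that, up to small norm, every entry of a coordinate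
  \<open>t\<close> in the support of \<open>x\<^sub>s\<close> is either below a constant \<open>H\<close> or close to an element of \<open>s\<close>. The
  coordinates with all entries below \<open>H\<close> cancel in alternating sums; those with some entries below
  \<open>H\<close> are controlled by the Schreier condition; for all others two consecutive entries of \<open>t\<close> are
  close to the same element of \<open>s\<close>, by the pigeonhole principle, so that no plegmatic family can meet
  two members of a plegma family. For \<open>k = 1\<close> and disjointly supported vectors this shows that the
  basis is shrinking, hence the space is reflexive.
\<close>

subsection \<open>Elements of finite sets of naturals\<close>

text \<open>A lower l1 estimate is blind to signs, so passing to alternating sums loses nothing. The
  signs are needed because the part of \<open>x_s\<close> living below \<open>H\<close> may be
  nearly the same for all \<open>s\<close> and would otherwise add up. In such a sum of length m the
  discarded and cancelled parts cost at most c/2 * m, with c as small as desired, while the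
  remaining parts grow only like sqrt m: a Schreier plegmatic family meets boundedly many summands,
  and Cauchy-Schwarz turns this into an upper 2-estimate. Hence m must be chosen after
  \<open>H\<close>, which enters that bound through the Schreier condition, but before the starting
  point of the plegma family, which the spreading model prescribes only once m is known. Order k + 1
  behaves in the opposite way because a plegma family that starts late enough fits into a single
  Schreier plegmatic family, on which the norm is l1. So does a fixed proportion of all (k +
  1)-subsets of a long initial segment of \<open>M\<close>: the product of consecutive blocks. This
  keeps the Cesaro means away from 0, although each of their coordinates tends to 0.\<close>

lemma el_mem:
  assumes "finite s" "1 \<le> i" "i \<le> card s"
  shows "el s i \<in> s"
proof -
  have "sorted_list_of_set s ! (i - 1) \<in> set (sorted_list_of_set s)"
    using assms by (intro nth_mem) auto
  then show ?thesis
    using assms by (simp add: el_def)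
qed

lemma el_less:
  assumes "finite s" "1 \<le> i" "i < i'" "i' \<le> card s"
  shows "el s i < el s i'"
  unfolding el_def
  using assms by (intro sorted_wrt_nth_less[OF strict_sorted_list_of_set]) auto

lemma el_mono:
  assumes "finite s" "1 \<le> i" "i \<le> i'" "i' \<le> card s"
  shows "el s i \<le> el s i'"
  using el_less[OF assms(1,2) _ assms(4)] assms(3) by (cases "i = i'") auto

lemma el_image_eq:
  assumes "finite s"
  shows "el s ` {1..card s} = s"
proof -
  have "el s ` {1..card s} = (!) (sorted_list_of_set s) ` {0..<length (sorted_list_of_set s)}"
  proof -
    have "{0..<card s} = (\<lambda>i. i - 1) ` {1..card s}"
      by (auto intro!: image_eqI[of _ _ "Suc _"])
    then show ?thesis
      by (simp add: el_def image_image)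
  qed
  also have "\<dots> = s"
    using assms nth_image[of "length (sorted_list_of_set s)" "sorted_list_of_set s"] by simp
  finally show ?thesis .
qed

text \<open>An element is located by its rank, the number of smaller elements. Positions in images
  and in enlarged sets are computed this way, without handling sorted lists.\<close>

lemma el_eqI:
  assumes "finite s" "z \<in> s" "card {y \<in> s. y < z} = q"
  shows "el s (Suc q) = z"
proof -
  obtain i where i: "1 \<le> i" "i \<le> card s" "z = el s i"
    using el_image_eq[OF assms(1)] assms(2) by (metis (no_types, lifting) atLeastAtMost_iff imageE)
  have less: "el s i' < el s i \<longleftrightarrow> i' < i" if "i' \<in> {1..card s}" for i'
    using that i el_less[OF assms(1)] el_mono[OF assms(1)]
    by (metis atLeastAtMost_iff leD not_le)
  have inj: "inj_on (el s) {1..card s}"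
    by (intro linorder_inj_onI) (use el_less[OF assms(1)] in \<open>force+\<close>)
  have "{y \<in> s. y < z} = {y \<in> el s ` {1..card s}. y < z}"
    using el_image_eq[OF assms(1)] by simp
  also have "\<dots> = el s ` {1..<i}"
    using less i by auto
  finally have "q = card (el s ` {1..<i})"
    using assms(3) by simp
  also have "\<dots> = i - 1"
    using i by (subst card_image) (auto intro: inj_on_subset[OF inj])
  finally show ?thesis
    using i by simp
qed

lemma el_image:
  assumes "strict_mono_on {1..k} f" "1 \<le> i" "i \<le> k"
  shows "el (f ` {1..k}) i = f i"
proof -
  have inj: "inj_on f {1..k}"
    using assms(1) by (rule strict_mono_on_imp_inj_on)
  have "{y \<in> f ` {1..k}. y < f i} = f ` {1..<i}"
    using assms by (auto simp: strict_mono_on_less)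
  then have "card {y \<in> f ` {1..k}. y < f i} = i - 1"
    using assms card_image[OF inj_on_subset[OF inj, of "{1..<i}"]] by force
  from el_eqI[OF _ _ this] show ?thesis
    using assms by auto
qed

subsection \<open>Schreier plegmatic families\<close>

lemma schreier_plegmatic_subset:
  assumes "schreier_plegmatic kk P" "Q \<subseteq> P"
  shows "schreier_plegmatic kk Q"
proof -
  obtain F where "plegmatic_witness kk P F" "card (F 1) \<le> Min (F 1)"
    using assms(1) by (auto simp: schreier_plegmatic_def)
  moreover from this(1) assms(2) have "plegmatic_witness kk Q F"
    unfolding plegmatic_witness_def by (meson subset_trans)
  ultimately show ?thesis
    by (auto simp: schreier_plegmatic_def)
qed

lemma schreier_plegmatic_ksubsets:
  "schreier_plegmatic kk P \<Longrightarrow> P \<subseteq> ksubsets NN kk"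
  by (auto simp: schreier_plegmatic_def plegmatic_witness_def)

lemma schreier_plegmatic_finite:
  assumes "schreier_plegmatic kk P"
  shows "finite P"
proof -
  obtain F where F: "plegmatic_witness kk P F"
    using assms by (auto simp: schreier_plegmatic_def)
  have "P \<subseteq> Pow (\<Union>i\<in>{1..kk}. F i)"
  proof
    fix s assume "s \<in> P"
    then have "finite s" "card s = kk" "\<forall>i\<in>{1..kk}. el s i \<in> F i"
      using F by (auto simp: plegmatic_witness_def ksubsets_def)
    then have "el s ` {1..card s} \<subseteq> (\<Union>i\<in>{1..kk}. F i)"
      by blast
    then show "s \<in> Pow (\<Union>i\<in>{1..kk}. F i)"
      using el_image_eq[OF \<open>finite s\<close>] by simp
  qed
  moreover have "finite (Pow (\<Union>i\<in>{1..kk}. F i))"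
    using F by (auto simp: plegmatic_witness_def)
  ultimately show ?thesis
    using finite_subset by blast
qed

text \<open>Blocks of size 1 reduce the Schreier condition to a least entry of at least 1, which
  holds because \<open>NN\<close> starts at 1. This is why the norm dominates every
  coordinate.\<close>

lemma schreier_plegmatic_singleton:
  assumes "s \<in> ksubsets NN kk" "1 \<le> kk"
  shows "schreier_plegmatic kk {s}"
proof -
  have s: "finite s" "card s = kk" "s \<subseteq> NN"
    using assms by (auto simp: ksubsets_def)
  then have "el s 1 \<in> NN"
    using el_mem[of s 1] assms by auto
  moreover have "plegmatic_witness kk {s} (\<lambda>i. {el s i})"
    unfolding plegmatic_witness_def
    using assms(1) el_less[OF s(1)] s(2) by simp
  ultimately show ?thesis
    unfolding schreier_plegmatic_def by (intro exI[of _ "\<lambda>i. {el s i}"]) (simp add: NN_def)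
qed

subsection \<open>The norm on finitely supported functions\<close>

lemma c00_finite: "x \<in> c00 kk \<Longrightarrow> finite {s. x s \<noteq> 0}"
  by (simp add: c00_def)

lemma c00_ksubsets: "x \<in> c00 kk \<Longrightarrow> x s \<noteq> 0 \<Longrightarrow> s \<in> ksubsets NN kk"
  by (simp add: c00_def)

lemma c00_dominated:
  assumes "x \<in> c00 kk" "\<And>s. x s = 0 \<Longrightarrow> y s = 0"
  shows "y \<in> c00 kk"
proof -
  have "{s. y s \<noteq> 0} \<subseteq> {s. x s \<noteq> 0}"
    using assms(2) by auto
  then show ?thesis
    using assms finite_subset by (auto simp: c00_def)
qed

lemma c00_add:
  assumes "x \<in> c00 kk" "y \<in> c00 kk"
  shows "(\<lambda>s. x s + y s) \<in> c00 kk"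
proof -
  have "{s. x s + y s \<noteq> 0} \<subseteq> {s. x s \<noteq> 0} \<union> {s. y s \<noteq> 0}"
    by auto
  then have "finite {s. x s + y s \<noteq> 0}"
    by (rule finite_subset) (use assms c00_finite in blast)
  moreover have "s \<in> ksubsets NN kk" if "x s + y s \<noteq> 0" for s
    using that assms[THEN c00_ksubsets, of s] by (cases "x s = 0") auto
  ultimately show ?thesis
    by (simp add: c00_def)
qed

lemma c00_zero: "(\<lambda>s. 0) \<in> c00 kk"
  by (simp add: c00_def)

lemma c00_cmult: "x \<in> c00 kk \<Longrightarrow> (\<lambda>s. c * x s) \<in> c00 kk"
  by (erule c00_dominated) auto

lemma c00_diff: "x \<in> c00 kk \<Longrightarrow> y \<in> c00 kk \<Longrightarrow> (\<lambda>t. x t - y t) \<in> c00 kk"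
  using c00_add[OF _ c00_cmult[of y kk "-1"]] by simp

lemma c00_sum:
  "(\<And>i. i \<in> I \<Longrightarrow> x i \<in> c00 kk) \<Longrightarrow> (\<lambda>s. \<Sum>i\<in>I. x i s) \<in> c00 kk"
  by (induction I rule: infinite_finite_induct) (auto intro: c00_zero c00_add)

lemma c00_unitvec: "s \<in> ksubsets NN kk \<Longrightarrow> unitvec s \<in> c00 kk"
  by (simp add: c00_def unitvec_def)

definition cutoff :: "nat set set \<Rightarrow> (nat set \<Rightarrow> real) \<Rightarrow> nat set \<Rightarrow> real" where
  "cutoff A x = (\<lambda>s. if s \<in> A then x s else 0)"

lemma c00_cutoff: "x \<in> c00 kk \<Longrightarrow> cutoff A x \<in> c00 kk"
  by (erule c00_dominated) (simp add: cutoff_def)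

text \<open>The index set is an arbitrary finite set rather than an initial segment, so that two
  collections can be merged over the disjoint sum of their index sets.\<close>

definition admissible :: "nat \<Rightarrow> 'i set \<Rightarrow> ('i \<Rightarrow> nat set set) \<Rightarrow> bool" where
  "admissible kk I P \<longleftrightarrow> finite I \<and> (\<forall>i\<in>I. schreier_plegmatic kk (P i)) \<and>
     (\<forall>i\<in>I. \<forall>i'\<in>I. i \<noteq> i' \<longrightarrow> P i \<inter> P i' = {})"

lemma Xnorm_eq_Sup:
  "Xnorm kk x = Sup {L2_set (\<lambda>i. \<Sum>s\<in>P i. \<bar>x s\<bar>) {1..n} | (n::nat) P. admissible kk {1..n} P}"
  by (simp add: Xnorm_def L2_set_def admissible_def)

text \<open>Disjoint families never count a coordinate twice, so the l1 norm bounds all members of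
  the supremum. This makes the real-valued \<open>Sup\<close> meaningful on
  \<open>c00\<close>.\<close>

lemma admissible_L2_set_le:
  assumes "x \<in> c00 kk" and P: "admissible kk I P"
  shows "L2_set (\<lambda>i. \<Sum>s\<in>P i. \<bar>x s\<bar>) I \<le> (\<Sum>s | x s \<noteq> 0. \<bar>x s\<bar>)"
proof -
  have fin: "finite (P i)" if "i \<in> I" for i
    using P that schreier_plegmatic_finite by (auto simp: admissible_def)
  have "L2_set (\<lambda>i. \<Sum>s\<in>P i. \<bar>x s\<bar>) I \<le> (\<Sum>i\<in>I. \<Sum>s\<in>P i. \<bar>x s\<bar>)"
    by (intro L2_set_le_sum sum_nonneg) auto
  also have "\<dots> = (\<Sum>s\<in>(\<Union>i\<in>I. P i). \<bar>x s\<bar>)"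
    using fin P by (subst sum.UNION_disjoint) (auto simp: admissible_def)
  also have "\<dots> = (\<Sum>s\<in>(\<Union>i\<in>I. P i) \<inter> {s. x s \<noteq> 0}. \<bar>x s\<bar>)"
    using fin P by (intro sum.mono_neutral_right) (auto simp: admissible_def)
  also have "\<dots> \<le> (\<Sum>s | x s \<noteq> 0. \<bar>x s\<bar>)"
    using c00_finite[OF assms(1)] by (intro sum_mono2) auto
  finally show ?thesis .
qed

lemma Xnorm_le:
  assumes "\<And>(n::nat) P. admissible kk {1..n} P \<Longrightarrow> L2_set (\<lambda>i. \<Sum>s\<in>P i. \<bar>x s\<bar>) {1..n} \<le> B"
  shows "Xnorm kk x \<le> B"
  unfolding Xnorm_eq_Sup
proof (rule cSup_least)
  have "admissible kk {1..0::nat} (\<lambda>_. {})"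
    by (simp add: admissible_def)
  then show "{L2_set (\<lambda>i. \<Sum>s\<in>P i. \<bar>x s\<bar>) {1..n} | (n::nat) P. admissible kk {1..n} P} \<noteq> {}"
    by blast
qed (use assms in blast)

lemma L2_set_reindex:
  assumes "inj_on h A"
  shows "L2_set f (h ` A) = L2_set (\<lambda>x. f (h x)) A"
  using assms by (simp add: L2_set_def sum.reindex)

lemma Xnorm_ge:
  assumes x: "x \<in> c00 kk" and P: "admissible kk I P"
  shows "L2_set (\<lambda>i. \<Sum>s\<in>P i. \<bar>x s\<bar>) I \<le> Xnorm kk x"
proof -
  have "finite I"
    using P by (simp add: admissible_def)
  then obtain h where h: "bij_betw h {1..card I} I"
    by (metis finite_same_card_bij card_atLeastAtMost diff_Suc_1 finite_atLeastAtMost)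
  then have hI: "h i \<in> I" if "i \<in> {1..card I}" for i
    using that by (auto simp: bij_betw_def)
  have hinj: "h i \<noteq> h i'" if "i \<in> {1..card I}" "i' \<in> {1..card I}" "i \<noteq> i'" for i i'
    using that inj_on_eq_iff[OF bij_betw_imp_inj_on[OF h]] by blast
  have Ph: "admissible kk {1..card I} (\<lambda>i. P (h i))"
    using P hI hinj by (simp add: admissible_def)
  have "L2_set (\<lambda>i. \<Sum>s\<in>P i. \<bar>x s\<bar>) I = L2_set (\<lambda>i. \<Sum>s\<in>P (h i). \<bar>x s\<bar>) {1..card I}"
    using h L2_set_reindex[of h "{1..card I}"] by (simp add: bij_betw_def)
  also have "\<dots> \<le> Xnorm kk x"
    unfolding Xnorm_eq_Sup
    by (rule cSup_upper)
      (use Ph admissible_L2_set_le[OF x] in \<open>auto intro!: bdd_aboveI[of _ "\<Sum>s | x s \<noteq> 0. \<bar>x s\<bar>"]\<close>)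
  finally show ?thesis .
qed

lemma Xnorm_nonneg: "x \<in> c00 kk \<Longrightarrow> 0 \<le> Xnorm kk x"
  using Xnorm_ge[of x kk "{}::nat set"] by (simp add: admissible_def)

lemma Xnorm_le_sum:
  assumes "x \<in> c00 kk" "finite A" "\<And>s. s \<notin> A \<Longrightarrow> x s = 0"
  shows "Xnorm kk x \<le> (\<Sum>s\<in>A. \<bar>x s\<bar>)"
proof -
  have "Xnorm kk x \<le> (\<Sum>s | x s \<noteq> 0. \<bar>x s\<bar>)"
    by (rule Xnorm_le) (rule admissible_L2_set_le[OF assms(1)])
  also have "\<dots> \<le> (\<Sum>s\<in>A. \<bar>x s\<bar>)"
    using assms by (intro sum_mono2) auto
  finally show ?thesis .
qed

lemma Xnorm_ge_family:
  assumes "x \<in> c00 kk" "schreier_plegmatic kk P"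
  shows "(\<Sum>s\<in>P. \<bar>x s\<bar>) \<le> Xnorm kk x"
  using Xnorm_ge[of x kk "{1::nat}" "\<lambda>_. P"] assms by (simp add: sum_nonneg admissible_def)

lemma Xnorm_ge_coord:
  assumes "x \<in> c00 kk" "s \<in> ksubsets NN kk" "1 \<le> kk"
  shows "\<bar>x s\<bar> \<le> Xnorm kk x"
  using Xnorm_ge_family[OF assms(1) schreier_plegmatic_singleton[OF assms(2,3)]] by simp

text \<open>The norm sees only absolute values: this is unconditionality with constant 1, and it
  makes restrictions to coordinate sets contractive.\<close>

lemma Xnorm_mono:
  assumes "y \<in> c00 kk" "\<And>s. \<bar>x s\<bar> \<le> \<bar>y s\<bar>"
  shows "Xnorm kk x \<le> Xnorm kk y"
proof (rule Xnorm_le)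
  fix n :: nat and P
  assume P: "admissible kk {1..n} P"
  have "L2_set (\<lambda>i. \<Sum>s\<in>P i. \<bar>x s\<bar>) {1..n} \<le> L2_set (\<lambda>i. \<Sum>s\<in>P i. \<bar>y s\<bar>) {1..n}"
    using assms by (intro L2_set_mono sum_mono sum_nonneg) auto
  also have "\<dots> \<le> Xnorm kk y"
    using P by (intro Xnorm_ge[OF assms(1)])
  finally show "L2_set (\<lambda>i. \<Sum>s\<in>P i. \<bar>x s\<bar>) {1..n} \<le> Xnorm kk y" .
qed

lemma Xnorm_abs_cong:
  assumes "x \<in> c00 kk" "\<And>s. \<bar>x s\<bar> = \<bar>y s\<bar>"
  shows "Xnorm kk x = Xnorm kk y"
proof (rule antisym)
  have "y \<in> c00 kk"
    by (rule c00_dominated[OF assms(1)]) (use assms(2) in \<open>metis abs_0_eq\<close>)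
  then show "Xnorm kk x \<le> Xnorm kk y"
    using assms by (intro Xnorm_mono) auto
  show "Xnorm kk y \<le> Xnorm kk x"
    using assms by (intro Xnorm_mono) auto
qed

lemma Xnorm_cutoff_le: "x \<in> c00 kk \<Longrightarrow> Xnorm kk (cutoff A x) \<le> Xnorm kk x"
  by (rule Xnorm_mono) (auto simp: cutoff_def)

lemma Xnorm_add:
  assumes "x \<in> c00 kk" "y \<in> c00 kk"
  shows "Xnorm kk (\<lambda>s. x s + y s) \<le> Xnorm kk x + Xnorm kk y"
proof (rule Xnorm_le)
  fix n :: nat and P
  assume P: "admissible kk {1..n} P"
  have "L2_set (\<lambda>i. \<Sum>s\<in>P i. \<bar>x s + y s\<bar>) {1..n}
      \<le> L2_set (\<lambda>i. (\<Sum>s\<in>P i. \<bar>x s\<bar>) + (\<Sum>s\<in>P i. \<bar>y s\<bar>)) {1..n}"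
    unfolding sum.distrib[symmetric] by (intro L2_set_mono sum_mono sum_nonneg) auto
  also have "\<dots> \<le> L2_set (\<lambda>i. \<Sum>s\<in>P i. \<bar>x s\<bar>) {1..n} + L2_set (\<lambda>i. \<Sum>s\<in>P i. \<bar>y s\<bar>) {1..n}"
    by (rule L2_set_triangle_ineq)
  also have "\<dots> \<le> Xnorm kk x + Xnorm kk y"
    using P by (intro add_mono Xnorm_ge assms)
  finally show "L2_set (\<lambda>i. \<Sum>s\<in>P i. \<bar>x s + y s\<bar>) {1..n} \<le> Xnorm kk x + Xnorm kk y" .
qed

lemma Xnorm_zero: "Xnorm kk (\<lambda>s. 0) = 0"
  using Xnorm_le_sum[of "\<lambda>s. 0" kk "{}"] Xnorm_nonneg[of "\<lambda>s. 0" kk] by (simp add: c00_zero)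

lemma Xnorm_sum:
  assumes "\<And>i. i \<in> I \<Longrightarrow> x i \<in> c00 kk"
  shows "Xnorm kk (\<lambda>s. \<Sum>i\<in>I. x i s) \<le> (\<Sum>i\<in>I. Xnorm kk (x i))"
  using assms
proof (induction I rule: infinite_finite_induct)
  case (insert i I)
  have "Xnorm kk (\<lambda>s. x i s + (\<Sum>i\<in>I. x i s)) \<le> Xnorm kk (x i) + Xnorm kk (\<lambda>s. \<Sum>i\<in>I. x i s)"
    using insert by (intro Xnorm_add c00_sum) auto
  then show ?case
    using insert by force
qed (auto simp: Xnorm_zero)

lemma Xnorm_unitvec:
  assumes "s \<in> ksubsets NN kk" "1 \<le> kk"
  shows "Xnorm kk (unitvec s) = 1"
proof (rule antisym)
  show "Xnorm kk (unitvec s) \<le> 1"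
    using Xnorm_le_sum[OF c00_unitvec[OF assms(1)], of "{s}"] by (simp add: unitvec_def)
  show "1 \<le> Xnorm kk (unitvec s)"
    using Xnorm_ge_coord[OF c00_unitvec[OF assms(1)] assms] by (simp add: unitvec_def)
qed

text \<open>Admissible families for \<open>x\<close> and for \<open>y\<close> can be cut down to the supports and then merged.\<close>

lemma Xnorm_lower_2_estimate:
  assumes x: "x \<in> c00 kk" and y: "y \<in> c00 kk" and xy: "\<And>s. x s = 0 \<or> y s = 0"
  shows "(Xnorm kk x)\<^sup>2 + (Xnorm kk y)\<^sup>2 \<le> (Xnorm kk (\<lambda>s. x s + y s))\<^sup>2"
proof -
  define z where "z = (\<lambda>s. x s + y s)"
  have z: "z \<in> c00 kk"
    unfolding z_def by (rule c00_add[OF x y])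
  have key: "(L2_set (\<lambda>i. \<Sum>s\<in>P i. \<bar>x s\<bar>) {1..n})\<^sup>2 + (L2_set (\<lambda>i. \<Sum>s\<in>Q i. \<bar>y s\<bar>) {1..n'})\<^sup>2
      \<le> (Xnorm kk z)\<^sup>2"
    if P: "admissible kk {1..n} P"
      and Q: "admissible kk {1..n'} Q"
    for n n' :: nat and P Q
  proof -
    define R where "R = case_sum (\<lambda>i. P i \<inter> {s. x s \<noteq> 0}) (\<lambda>i. Q i \<inter> {s. y s \<noteq> 0})"
    have "L2_set (\<lambda>i. \<Sum>s\<in>R i. \<bar>z s\<bar>) ({1..n} <+> {1..n'}) \<le> Xnorm kk z"
    proof (rule Xnorm_ge[OF z])
      show "admissible kk ({1..n} <+> {1..n'}) R"
        unfolding admissible_def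
      proof (intro conjI ballI impI)
        fix i i' assume i: "i \<in> {1..n} <+> {1..n'}"
        then show "schreier_plegmatic kk (R i)"
          using P Q schreier_plegmatic_subset[OF _ Int_lower1]
          by (cases i) (auto simp: R_def admissible_def)
        assume "i' \<in> {1..n} <+> {1..n'}" "i \<noteq> i'"
        then show "R i \<inter> R i' = {}"
        proof (cases i; cases i')
          fix a b assume "i = Inl a" "i' = Inl b"
          then have "P a \<inter> P b = {}"
            using P i \<open>i' \<in> _\<close> \<open>i \<noteq> i'\<close> unfolding admissible_def by blast
          then show ?thesis
            using \<open>i = Inl a\<close> \<open>i' = Inl b\<close> by (auto simp: R_def)
        next
          fix a b assume "i = Inr a" "i' = Inr b"
          then have "Q a \<inter> Q b = {}"
            using Q i \<open>i' \<in> _\<close> \<open>i \<noteq> i'\<close> unfolding admissible_def by blast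
          then show ?thesis
            using \<open>i = Inr a\<close> \<open>i' = Inr b\<close> by (auto simp: R_def)
        qed (use xy in \<open>auto simp: R_def\<close>)
      qed auto
    qed
    then have "(L2_set (\<lambda>i. \<Sum>s\<in>R i. \<bar>z s\<bar>) ({1..n} <+> {1..n'}))\<^sup>2 \<le> (Xnorm kk z)\<^sup>2"
      by (intro power_mono) auto
    moreover have "(\<Sum>s\<in>R (Inl i). \<bar>z s\<bar>) = (\<Sum>s\<in>P i. \<bar>x s\<bar>)" if "i \<in> {1..n}" for i
    proof -
      have "(\<Sum>s\<in>R (Inl i). \<bar>z s\<bar>) = (\<Sum>s\<in>R (Inl i). \<bar>x s\<bar>)"
        by (intro sum.cong refl) (use xy in \<open>force simp: R_def z_def\<close>)
      also have "\<dots> = (\<Sum>s\<in>P i. \<bar>x s\<bar>)"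
        using schreier_plegmatic_finite[of kk "P i"] P that
        by (intro sum.mono_neutral_left) (auto simp: R_def admissible_def)
      finally show ?thesis .
    qed
    moreover have "(\<Sum>s\<in>R (Inr i). \<bar>z s\<bar>) = (\<Sum>s\<in>Q i. \<bar>y s\<bar>)" if "i \<in> {1..n'}" for i
    proof -
      have "(\<Sum>s\<in>R (Inr i). \<bar>z s\<bar>) = (\<Sum>s\<in>R (Inr i). \<bar>y s\<bar>)"
        by (intro sum.cong refl) (use xy in \<open>force simp: R_def z_def\<close>)
      also have "\<dots> = (\<Sum>s\<in>Q i. \<bar>y s\<bar>)"
        using schreier_plegmatic_finite[of kk "Q i"] Q that
        by (intro sum.mono_neutral_left) (auto simp: R_def admissible_def)
      finally show ?thesis .
    qed
    ultimately show ?thesis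
      by (simp add: L2_set_def sum_nonneg sum.Plus)
  qed
  have sq: "a\<^sup>2 \<le> b \<Longrightarrow> a \<le> sqrt b" for a b :: real
    by (rule real_le_rsqrt)
  \<comment> \<open>The suprema are taken one at a time: \<open>P\<close> stays fixed while the
    families for \<open>y\<close> vary, and afterwards the families for \<open>x\<close> vary.
    Square roots appear because \<open>Xnorm_le\<close> bounds the unsquared quantity.\<close>
  have half: "(L2_set (\<lambda>i. \<Sum>s\<in>P i. \<bar>x s\<bar>) {1..n})\<^sup>2 + (Xnorm kk y)\<^sup>2 \<le> (Xnorm kk z)\<^sup>2"
    if P: "admissible kk {1..n} P"
    for n :: nat and P
  proof -
    let ?a = "(L2_set (\<lambda>i. \<Sum>s\<in>P i. \<bar>x s\<bar>) {1..n})\<^sup>2"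
    have "?a \<le> (Xnorm kk z)\<^sup>2"
      using key[OF P, of 0 "\<lambda>_. {}"] by (simp add: admissible_def)
    moreover have "Xnorm kk y \<le> sqrt ((Xnorm kk z)\<^sup>2 - ?a)"
      by (rule Xnorm_le, rule sq) (use key[OF P] in \<open>simp add: algebra_simps\<close>)
    ultimately have "(Xnorm kk y)\<^sup>2 \<le> (Xnorm kk z)\<^sup>2 - ?a"
      using Xnorm_nonneg[OF y] by (metis power_mono real_sqrt_pow2 diff_ge_0_iff_ge)
    then show ?thesis by simp
  qed
  have "(Xnorm kk y)\<^sup>2 \<le> (Xnorm kk z)\<^sup>2"
    using half[of 0 "\<lambda>_. {}"] by (simp add: admissible_def)
  moreover have "Xnorm kk x \<le> sqrt ((Xnorm kk z)\<^sup>2 - (Xnorm kk y)\<^sup>2)"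
    by (rule Xnorm_le, rule sq) (use half in \<open>simp add: algebra_simps\<close>)
  ultimately have "(Xnorm kk x)\<^sup>2 \<le> (Xnorm kk z)\<^sup>2 - (Xnorm kk y)\<^sup>2"
    using Xnorm_nonneg[OF x] by (metis power_mono real_sqrt_pow2 diff_ge_0_iff_ge)
  then show ?thesis
    by (simp add: z_def)
qed

lemma Xnorm_lower_2_estimate_sum:
  assumes "finite I" "\<And>i. i \<in> I \<Longrightarrow> x i \<in> c00 kk"
    and "\<And>i i' s. i \<in> I \<Longrightarrow> i' \<in> I \<Longrightarrow> i \<noteq> i' \<Longrightarrow> x i s = 0 \<or> x i' s = 0"
  shows "(\<Sum>i\<in>I. (Xnorm kk (x i))\<^sup>2) \<le> (Xnorm kk (\<lambda>s. \<Sum>i\<in>I. x i s))\<^sup>2"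
  using assms
proof (induction I rule: finite_induct)
  case (insert i I)
  have "(Xnorm kk (x i))\<^sup>2 + (Xnorm kk (\<lambda>s. \<Sum>i\<in>I. x i s))\<^sup>2
      \<le> (Xnorm kk (\<lambda>s. x i s + (\<Sum>i\<in>I. x i s)))\<^sup>2"
  proof (rule Xnorm_lower_2_estimate)
    show "x i s = 0 \<or> (\<Sum>i\<in>I. x i s) = 0" for s
    proof (cases "x i s = 0")
      case False
      then have "\<forall>i'\<in>I. x i' s = 0"
        using insert.prems(2)[of i _ s] insert.hyps by auto
      then show ?thesis by simp
    qed simp
  qed (use insert in \<open>auto intro: c00_sum\<close>)
  moreover have "(\<Sum>i\<in>I. (Xnorm kk (x i))\<^sup>2) \<le> (Xnorm kk (\<lambda>s. \<Sum>i\<in>I. x i s))\<^sup>2"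
    using insert by simp
  ultimately show ?case
    using insert.hyps by simp
qed simp

text \<open>Let \<open>p i j\<close> be the mass that the i-th family finds in \<open>z j\<close>.
  Each row of this matrix has at most \<open>h\<close> nonzero entries, so Cauchy-Schwarz costs a
  factor \<open>h\<close>; each column has square sum at most \<open>C\<^sup>2\<close>. The norm
  thus grows like the square root of the number of summands.\<close>

lemma Xnorm_upper_2_estimate:
  assumes J: "finite J" and z: "\<And>j. j \<in> J \<Longrightarrow> z j \<in> c00 kk"
    and C: "\<And>j. j \<in> J \<Longrightarrow> Xnorm kk (z j) \<le> C"
    and meet: "\<And>P. schreier_plegmatic kk P \<Longrightarrow> card {j \<in> J. \<exists>s\<in>P. z j s \<noteq> 0} \<le> h"
  shows "Xnorm kk (\<lambda>s. \<Sum>j\<in>J. z j s) \<le> sqrt (real h * real (card J)) * C"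
proof (rule Xnorm_le)
  fix n :: nat and P
  assume P: "admissible kk {1..n} P"
  define p where "p = (\<lambda>i j. \<Sum>s\<in>P i. \<bar>z j s\<bar>)"
  have row: "(\<Sum>s\<in>P i. \<bar>\<Sum>j\<in>J. z j s\<bar>)\<^sup>2 \<le> h * (\<Sum>j\<in>J. (p i j)\<^sup>2)" if i: "i \<in> {1..n}" for i
  proof -
    let ?K = "{j \<in> J. \<exists>s\<in>P i. z j s \<noteq> 0}"
    have "(\<Sum>s\<in>P i. \<bar>\<Sum>j\<in>J. z j s\<bar>) \<le> (\<Sum>s\<in>P i. \<Sum>j\<in>J. \<bar>z j s\<bar>)"
      by (intro sum_mono sum_abs)
    also have "\<dots> = (\<Sum>j\<in>J. p i j)"
      unfolding p_def by (rule sum.swap)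
    also have "\<dots> = (\<Sum>j\<in>?K. p i j)"
      using J by (intro sum.mono_neutral_right) (auto simp: p_def)
    finally have "(\<Sum>s\<in>P i. \<bar>\<Sum>j\<in>J. z j s\<bar>)\<^sup>2 \<le> (\<Sum>j\<in>?K. p i j)\<^sup>2"
      by (intro power_mono) (auto intro: sum_nonneg)
    also have "\<dots> \<le> (\<Sum>j\<in>?K. (p i j)\<^sup>2) * card ?K"
      by (rule sum_squared_le_sum_of_squares)
    also have "\<dots> \<le> (\<Sum>j\<in>J. (p i j)\<^sup>2) * h"
      using meet[of "P i"] P i J by (intro mult_mono sum_mono2) (auto intro: sum_nonneg simp: admissible_def)
    finally show ?thesis
      by (simp add: mult.commute)
  qed
  have col: "(\<Sum>i=1..n. (p i j)\<^sup>2) \<le> C\<^sup>2" if j: "j \<in> J" for j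
  proof -
    have "L2_set (\<lambda>i. p i j) {1..n} \<le> C"
      unfolding p_def using P C[OF j] by (intro order_trans[OF Xnorm_ge[OF z[OF j]]]) auto
    then have "(L2_set (\<lambda>i. p i j) {1..n})\<^sup>2 \<le> C\<^sup>2"
      by (intro power_mono) auto
    then show ?thesis
      by (simp add: L2_set_def sum_nonneg)
  qed
  have "(L2_set (\<lambda>i. \<Sum>s\<in>P i. \<bar>\<Sum>j\<in>J. z j s\<bar>) {1..n})\<^sup>2 = (\<Sum>i=1..n. (\<Sum>s\<in>P i. \<bar>\<Sum>j\<in>J. z j s\<bar>)\<^sup>2)"
    by (simp add: L2_set_def sum_nonneg)
  also have "\<dots> \<le> (\<Sum>i=1..n. h * (\<Sum>j\<in>J. (p i j)\<^sup>2))"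
    by (intro sum_mono row)
  also have "\<dots> = h * (\<Sum>j\<in>J. \<Sum>i=1..n. (p i j)\<^sup>2)"
    by (simp add: sum_distrib_left[symmetric] sum.swap[of _ J])
  also have "\<dots> \<le> h * (\<Sum>j\<in>J. C\<^sup>2)"
    by (intro mult_left_mono sum_mono col) auto
  also have "\<dots> = (sqrt (real h * real (card J)) * C)\<^sup>2"
    by (simp add: power_mult_distrib)
  finally have sq: "(L2_set (\<lambda>i. \<Sum>s\<in>P i. \<bar>\<Sum>j\<in>J. z j s\<bar>) {1..n})\<^sup>2
      \<le> (sqrt (real h * real (card J)) * C)\<^sup>2" .
  show "L2_set (\<lambda>i. \<Sum>s\<in>P i. \<bar>\<Sum>j\<in>J. z j s\<bar>) {1..n} \<le> sqrt (real h * real (card J)) * C"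
  proof (cases "J = {}")
    case False
    then obtain j where "j \<in> J" by auto
    then have "0 \<le> C"
      using C[of j] Xnorm_nonneg[OF z[of j]] by linarith
    then have "0 \<le> sqrt (real h * real (card J)) * C"
      by simp
    with sq show ?thesis
      by (rule power2_le_imp_le)
  qed (simp add: L2_set_def)
qed

subsection \<open>Ramsey theory for bounded functions\<close>

lemma ksubsets_mono: "A \<subseteq> B \<Longrightarrow> ksubsets A k \<subseteq> ksubsets B k"
  by (auto simp: ksubsets_def)

text \<open>The colour of a set is the index of the interval of length \<open>\<eta>\<close> that
  contains its value. Boundedness leaves finitely many colours, and the shift by \<open>C\<close>
  makes the index nonnegative, so that \<open>nat\<close> loses nothing.\<close>

lemma Ramsey_almost_constant:
  fixes f :: "nat set \<Rightarrow> real"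
  assumes Z: "infinite Z" and f: "\<And>X. X \<in> ksubsets Z r \<Longrightarrow> \<bar>f X\<bar> \<le> C" and "0 < \<eta>"
  obtains Y where "Y \<subseteq> Z" "infinite Y"
    "\<And>X X'. X \<in> ksubsets Y r \<Longrightarrow> X' \<in> ksubsets Y r \<Longrightarrow> \<bar>f X - f X'\<bar> \<le> \<eta>"
proof -
  define g where "g = (\<lambda>X. nat \<lfloor>(f X + C) / \<eta>\<rfloor>)"
  have "g X < nat \<lfloor>2 * C / \<eta>\<rfloor> + 1" if "X \<in> ksubsets Z r" for X
  proof -
    have "(f X + C) / \<eta> \<le> 2 * C / \<eta>"
      using f[OF that] \<open>0 < \<eta>\<close> by (intro divide_right_mono) auto
    then have "\<lfloor>(f X + C) / \<eta>\<rfloor> \<le> \<lfloor>2 * C / \<eta>\<rfloor>"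
      by (rule floor_mono)
    then show ?thesis
      by (simp add: g_def nat_mono le_imp_less_Suc)
  qed
  then obtain Y t where Y: "Y \<subseteq> Z" "infinite Y"
    and t: "\<forall>X. X \<subseteq> Y \<and> finite X \<and> card X = r \<longrightarrow> g X = t"
    using Ramsey[OF Z, of r g "nat \<lfloor>2 * C / \<eta>\<rfloor> + 1"] by (auto simp: ksubsets_def)
  have "\<bar>f X - f X'\<bar> \<le> \<eta>" if X: "X \<in> ksubsets Y r" "X' \<in> ksubsets Y r" for X X'
  proof -
    have *: "real t \<le> (f X + C) / \<eta> \<and> (f X + C) / \<eta> < real t + 1" if "X \<in> ksubsets Y r" for X
    proof -
      have "X \<in> ksubsets Z r"
        using ksubsets_mono[OF Y(1)] that by blast
      then have "0 \<le> (f X + C) / \<eta>"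
        using f[of X] \<open>0 < \<eta>\<close> by (intro divide_nonneg_pos) auto
      moreover have "nat \<lfloor>(f X + C) / \<eta>\<rfloor> = t"
        using t that by (auto simp: ksubsets_def g_def)
      ultimately show ?thesis
        by linarith
    qed
    from *[OF X(1)] *[OF X(2)] have "\<bar>(f X + C) / \<eta> - (f X' + C) / \<eta>\<bar> \<le> 1"
      by linarith
    then have "\<bar>(f X - f X') / \<eta>\<bar> \<le> 1"
      by (simp add: diff_divide_distrib add_divide_distrib)
    then show ?thesis
      using \<open>0 < \<eta>\<close> by (simp add: abs_divide)
  qed
  with Y show ?thesis
    by (rule that)
qed

lemma Ramsey_almost_constant_finite:
  fixes f :: "'i \<Rightarrow> nat set \<Rightarrow> real"
  assumes "finite I" "infinite Z" "\<And>i X. i \<in> I \<Longrightarrow> X \<in> ksubsets Z r \<Longrightarrow> \<bar>f i X\<bar> \<le> C" "0 < \<eta>"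
  shows "\<exists>Y\<subseteq>Z. infinite Y \<and> (\<forall>i\<in>I. \<forall>X\<in>ksubsets Y r. \<forall>X'\<in>ksubsets Y r. \<bar>f i X - f i X'\<bar> \<le> \<eta>)"
  using assms
proof (induction I rule: finite_induct)
  case (insert i I)
  then obtain Y where Y: "Y \<subseteq> Z" "infinite Y"
    "\<forall>i\<in>I. \<forall>X\<in>ksubsets Y r. \<forall>X'\<in>ksubsets Y r. \<bar>f i X - f i X'\<bar> \<le> \<eta>"
    by auto
  have "\<bar>f i X\<bar> \<le> C" if "X \<in> ksubsets Y r" for X
    using insert.prems(2)[of i X] ksubsets_mono[OF Y(1)] that by auto
  then obtain Y' where Y': "Y' \<subseteq> Y" "infinite Y'"
    "\<And>X X'. X \<in> ksubsets Y' r \<Longrightarrow> X' \<in> ksubsets Y' r \<Longrightarrow> \<bar>f i X - f i X'\<bar> \<le> \<eta>"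
    using Ramsey_almost_constant[OF Y(2) _ \<open>0 < \<eta>\<close>, of r "f i" C] by metis
  moreover have "\<bar>f i' X - f i' X'\<bar> \<le> \<eta>"
    if "i' \<in> I" "X \<in> ksubsets Y' r" "X' \<in> ksubsets Y' r" for i' X X'
    using Y(3) that ksubsets_mono[OF Y'(1)] by blast
  ultimately show ?case
    using Y by (intro exI[of _ Y']) auto
qed auto

subsection \<open>Small gaps\<close>

text \<open>Since \<open>s\<close> avoids the whole interval, \<open>z\<close> and \<open>z'\<close>
  are neighbours in the enlarged set. The triple of \<open>s\<close>, \<open>z\<close>,
  \<open>z'\<close> is thus coded by one set and one position, which is a form that Ramsey's theorem
  can colour.\<close>

lemma el_insert_gap:
  assumes "finite s" "z < z'" "s \<inter> {z..z'} = {}"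
  shows "el (insert z (insert z' s)) (Suc (card {y \<in> s. y < z})) = z"
    and "el (insert z (insert z' s)) (Suc (Suc (card {y \<in> s. y < z}))) = z'"
proof -
  have "{y \<in> insert z (insert z' s). y < z} = {y \<in> s. y < z}"
    using assms by auto
  then show "el (insert z (insert z' s)) (Suc (card {y \<in> s. y < z})) = z"
    using assms by (intro el_eqI) auto
  have "y < z" if "y \<in> s" "y < z'" for y
    using that assms(3) by (meson atLeastAtMost_iff disjoint_iff less_imp_le not_le)
  then have "{y \<in> insert z (insert z' s). y < z'} = insert z {y \<in> s. y < z}"
    using assms by auto
  then have "card {y \<in> insert z (insert z' s). y < z'} = Suc (card {y \<in> s. y < z})"
    using assms by simp
  then show "el (insert z (insert z' s)) (Suc (Suc (card {y \<in> s. y < z}))) = z'"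
    using assms by (intro el_eqI) auto
qed

lemma sum_cutoff_disjoint:
  assumes "finite I" "\<And>i i'. i \<in> I \<Longrightarrow> i' \<in> I \<Longrightarrow> i \<noteq> i' \<Longrightarrow> A i \<inter> A i' = {}"
  shows "(\<Sum>i\<in>I. cutoff (A i) x t) = cutoff (\<Union>i\<in>I. A i) x t"
proof (cases "\<exists>i\<in>I. t \<in> A i")
  case True
  then obtain i where i: "i \<in> I" "t \<in> A i" by blast
  have "cutoff (A i') x t = 0" if "i' \<in> I - {i}" for i'
    using assms(2)[of i i'] i that by (auto simp: cutoff_def)
  then have "(\<Sum>i\<in>I. cutoff (A i) x t) = cutoff (A i) x t"
    using sum.remove[OF assms(1) i(1), of "\<lambda>i. cutoff (A i) x t"] by simp
  then show ?thesis
    using i by (auto simp: cutoff_def)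
qed (auto simp: cutoff_def)

text \<open>Otherwise, by Ramsey's theorem, many disjoint intervals avoiding some \<open>s\<close> would carry a fixed
  amount of the norm of \<open>w s\<close>, against the lower 2-estimate.\<close>

lemma small_gaps:
  assumes M: "infinite M" and w: "\<And>s. s \<in> ksubsets M k \<Longrightarrow> w s \<in> c00 kk"
    and C: "\<And>s. s \<in> ksubsets M k \<Longrightarrow> Xnorm kk (w s) \<le> C" and "0 < \<delta>"
  shows "\<exists>Y\<subseteq>M. infinite Y \<and> (\<forall>s\<in>ksubsets Y k. \<forall>z\<in>Y. \<forall>z'\<in>Y. \<forall>i\<in>{1..kk}.
    z < z' \<longrightarrow> s \<inter> {z..z'} = {} \<longrightarrow> Xnorm kk (cutoff {t. z \<le> el t i \<and> el t i < z'} (w s)) \<le> \<delta>)"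
proof -
  define A where "A = (\<lambda>i z z'. {t. z \<le> el t i \<and> el t i < z'})"
  \<comment> \<open>A set \<open>u\<close> of size k + 2 codes a k-set together with a gap whose
    ends have positions q + 1 and q + 2 in \<open>u\<close>. All pairs (\<open>i\<close>,
    \<open>q\<close>) are made homogeneous at once, as the position of a bad gap is not known
    beforehand.\<close>
  define G where "G = (\<lambda>(i, q) u. Xnorm kk (cutoff (A i (el u (Suc q)) (el u (Suc (Suc q))))
    (w (u - {el u (Suc q), el u (Suc (Suc q))}))))"
  have bound: "\<bar>G x u\<bar> \<le> C" if x: "x \<in> {1..kk} \<times> {0..k}" and u: "u \<in> ksubsets M (k + 2)" for x u
  proof -
    obtain i q where iq: "x = (i, q)" by (cases x)
    then have "q \<le> k" using x by auto
    have u': "finite u" "card u = k + 2" "u \<subseteq> M"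
      using u by (auto simp: ksubsets_def)
    have mem: "el u (Suc q) \<in> u" "el u (Suc (Suc q)) \<in> u"
      using u' \<open>q \<le> k\<close> by (auto intro!: el_mem)
    moreover have "el u (Suc q) \<noteq> el u (Suc (Suc q))"
      using u' \<open>q \<le> k\<close> el_less[of u "Suc q" "Suc (Suc q)"] by simp
    ultimately have "u - {el u (Suc q), el u (Suc (Suc q))} \<in> ksubsets M k"
      using u' by (auto simp: ksubsets_def card_Diff_subset)
    note u'' = w[OF this] C[OF this]
    then show ?thesis
      using order_trans[OF Xnorm_cutoff_le[OF u''(1)] u''(2)] Xnorm_nonneg[OF c00_cutoff[OF u''(1)]]
      by (simp add: iq G_def)
  qed
  obtain Y where Y: "Y \<subseteq> M" "infinite Y"
    and hom: "\<forall>x\<in>{1..kk} \<times> {0..k}. \<forall>u\<in>ksubsets Y (k + 2). \<forall>u'\<in>ksubsets Y (k + 2).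
        \<bar>G x u - G x u'\<bar> \<le> \<delta> / 2"
    using Ramsey_almost_constant_finite[of "{1..kk} \<times> {0..k}" M "k + 2" G C "\<delta> / 2"]
      bound M \<open>0 < \<delta>\<close> by auto
  have G_eq: "G (i, card {y \<in> s. y < z}) (insert z (insert z' s)) = Xnorm kk (cutoff (A i z z') (w s))"
    and in_ksubsets: "insert z (insert z' s) \<in> ksubsets Y (k + 2)"
    if "s \<in> ksubsets Y k" "z \<in> Y" "z' \<in> Y" "z < z'" "s \<inter> {z..z'} = {}" for i s z z'
  proof -
    have s: "finite s" "s \<subseteq> Y" "card s = k"
      using that by (auto simp: ksubsets_def)
    have ns: "z \<notin> s" "z' \<notin> s"
      using that by auto
    then have "insert z (insert z' s) - {z, z'} = s"
      by auto
    then show "G (i, card {y \<in> s. y < z}) (insert z (insert z' s)) = Xnorm kk (cutoff (A i z z') (w s))"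
      using el_insert_gap[OF s(1) that(4,5)] by (simp add: G_def)
    show "insert z (insert z' s) \<in> ksubsets Y (k + 2)"
      using s ns that by (auto simp: ksubsets_def)
  qed
  have "Xnorm kk (cutoff (A i z z') (w s)) \<le> \<delta>"
    if s: "s \<in> ksubsets Y k" "z \<in> Y" "z' \<in> Y" "z < z'" "s \<inter> {z..z'} = {}" and i: "i \<in> {1..kk}"
    for s z z' i
  proof (rule ccontr)
    assume neg: "\<not> Xnorm kk (cutoff (A i z z') (w s)) \<le> \<delta>"
    define q where "q = card {y \<in> s. y < z}"
    have "q \<le> k"
      using s card_mono[of s "{y \<in> s. y < z}"] by (auto simp: q_def ksubsets_def)
    \<comment> \<open>With tolerance \<open>\<delta> / 2\<close>, a single gap carrying more than
      \<open>\<delta>\<close> forces more than \<open>\<delta> / 2\<close> on every gap at the same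
      position \<open>q\<close>.\<close>
    have big: "\<delta> / 2 < G (i, q) u" if "u \<in> ksubsets Y (k + 2)" for u
    proof -
      have "\<bar>G (i, q) u - G (i, q) (insert z (insert z' s))\<bar> \<le> \<delta> / 2"
        using hom that in_ksubsets[OF s] i \<open>q \<le> k\<close> by auto
      moreover have "\<delta> < G (i, q) (insert z (insert z' s))"
        using neg G_eq[OF s] by (simp add: q_def)
      ultimately show ?thesis by linarith
    qed
    obtain n where n: "C\<^sup>2 < real n * (\<delta> / 2)\<^sup>2"
      using \<open>0 < \<delta>\<close> reals_Archimedean3[of "(\<delta> / 2)\<^sup>2"] by auto
    define v where "v = enumerate Y"
    have vY: "v a \<in> Y" for a
      unfolding v_def using Y(2) by (rule enumerate_in_set)
    have v_less: "v a < v b \<longleftrightarrow> a < b" for a b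
      unfolding v_def using Y(2) by simp
    have v_inj: "inj_on v B" for B
      by (intro inj_onI) (metis v_less less_irrefl linorder_neqE_nat)
    \<comment> \<open>\<open>S\<close> has q elements below and k - q elements above the n + 1
      reserved points with indices q to q + n. The n intervals between neighbouring reserved points
      are gaps of this one \<open>S\<close>, all at position \<open>q\<close>.\<close>
    define S where "S = v ` ({..<q} \<union> {q + n + 1..<n + k + 1})"
    have S: "S \<in> ksubsets Y k"
    proof -
      have "card S = card ({..<q} \<union> {q + n + 1..<n + k + 1})"
        unfolding S_def by (rule card_image[OF v_inj])
      also have "\<dots> = card {..<q} + card {q + n + 1..<n + k + 1}"
        by (rule card_Un_disjoint) auto
      finally have "card S = k"
        using \<open>q \<le> k\<close> by simp
      then show ?thesis
        using vY by (auto simp: ksubsets_def S_def)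
    qed
    then have SM: "S \<in> ksubsets M k"
      using ksubsets_mono[OF Y(1)] by blast
    have piece: "\<delta> / 2 < Xnorm kk (cutoff (A i (v (q + r)) (v (q + Suc r))) (w S))" if "r < n" for r
    proof -
      have disj: "S \<inter> {v (q + r)..v (q + Suc r)} = {}"
        using that by (auto simp: S_def not_less[symmetric] v_less)
      have "{y \<in> S. y < v (q + r)} = v ` {..<q}"
        using that by (auto simp: S_def v_less)
      then have "card {y \<in> S. y < v (q + r)} = q"
        by (simp add: card_image[OF v_inj])
      then show ?thesis
        using G_eq[OF S vY vY _ disj, of i] big[OF in_ksubsets[OF S vY vY _ disj]] by (simp add: v_less)
    qed
    have disj: "A i (v (q + r)) (v (q + Suc r)) \<inter> A i (v (q + r')) (v (q + Suc r')) = {}"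
      if "r \<noteq> r'" for r r'
    proof -
      have *: "A i (v (q + r)) (v (q + Suc r)) \<inter> A i (v (q + r')) (v (q + Suc r')) = {}"
        if "r < r'" for r r'
      proof -
        have "v (q + Suc r) \<le> v (q + r')"
          using that by (simp add: not_less[symmetric] v_less)
        then show ?thesis by (auto simp: A_def)
      qed
      show ?thesis
        using that *[of r r'] *[of r' r] by (cases "r < r'") auto
    qed
    have "real n * (\<delta> / 2)\<^sup>2 = (\<Sum>r<n. (\<delta> / 2)\<^sup>2)"
      by simp
    also have "\<dots> \<le> (\<Sum>r<n. (Xnorm kk (cutoff (A i (v (q + r)) (v (q + Suc r))) (w S)))\<^sup>2)"
      using piece \<open>0 < \<delta>\<close> by (intro sum_mono power_mono less_imp_le) auto
    also have "\<dots> \<le> (Xnorm kk (\<lambda>t. \<Sum>r<n. cutoff (A i (v (q + r)) (v (q + Suc r))) (w S) t))\<^sup>2"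
      using disj w[OF SM] by (intro Xnorm_lower_2_estimate_sum c00_cutoff) (auto simp: cutoff_def)
    also have "\<dots> = (Xnorm kk (cutoff (\<Union>r<n. A i (v (q + r)) (v (q + Suc r))) (w S)))\<^sup>2"
      by (subst sum_cutoff_disjoint[OF _ disj]) auto
    also have "\<dots> \<le> C\<^sup>2"
      using C[OF SM] w[OF SM] Xnorm_cutoff_le[OF w[OF SM]]
      by (intro power_mono) (auto intro: order_trans Xnorm_nonneg c00_cutoff)
    finally show False
      using n by simp
  qed
  then show ?thesis
    using Y by (intro exI[of _ Y]) (auto simp: A_def)
qed

subsection \<open>No lower \<open>\<ell>\<^sup>1\<close> estimates on plegma families\<close>

text \<open>Neighbouring terms pair off into differences of size at most \<open>\<eta>\<close>; the
  even length leaves no term over.\<close>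

lemma alternating_sum_bound:
  fixes f :: "nat \<Rightarrow> real"
  assumes "\<And>j j'. j \<in> {1..2 * N} \<Longrightarrow> j' \<in> {1..2 * N} \<Longrightarrow> \<bar>f j - f j'\<bar> \<le> \<eta>"
  shows "\<bar>\<Sum>j=1..2 * N. (-1) ^ j * f j\<bar> \<le> real N * \<eta>"
  using assms
proof (induction N)
  case (Suc N)
  have "\<bar>\<Sum>j=1..2 * N. (-1) ^ j * f j\<bar> \<le> real N * \<eta>"
    using Suc by auto
  moreover have "\<bar>f (Suc (Suc (2 * N))) - f (Suc (2 * N))\<bar> \<le> \<eta>"
    using Suc.prems by simp
  moreover have "(\<Sum>j=1..2 * Suc N. (-1) ^ j * f j)
      = (\<Sum>j=1..2 * N. (-1) ^ j * f j) + (f (Suc (Suc (2 * N))) - f (Suc (2 * N)))"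
    by simp
  moreover have "real (Suc N) * \<eta> = real N * \<eta> + \<eta>"
    by (simp add: algebra_simps)
  ultimately show ?case
    by linarith
qed simp

text \<open>At most one summand is nonzero, so the signs affect only the sign of the sum. This
  converts the alternating estimate into one for plain sums of disjointly supported vectors.\<close>

lemma alternating_sum_disjoint:
  fixes x :: "nat \<Rightarrow> real"
  assumes "\<And>a b. a \<in> A \<Longrightarrow> b \<in> A \<Longrightarrow> a \<noteq> b \<Longrightarrow> x a = 0 \<or> x b = 0"
  shows "\<bar>\<Sum>a\<in>A. (-1) ^ a * x a\<bar> = \<bar>\<Sum>a\<in>A. x a\<bar>"
proof (cases "finite A \<and> (\<exists>a\<in>A. x a \<noteq> 0)")
  case True
  then obtain a where a: "a \<in> A" "x a \<noteq> 0" "finite A" by blast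
  then have "\<And>b. b \<in> A - {a} \<Longrightarrow> x b = 0"
    using assms[OF a(1)] by auto
  then show ?thesis
    using sum.remove[OF a(3,1), of x] sum.remove[OF a(3,1), of "\<lambda>a. (-1) ^ a * x a"]
    by (simp add: abs_mult power_abs)
qed auto

text \<open>The Schreier bound on \<open>F 1\<close> carries over to every \<open>F i\<close>, all
  having the same size, and is restated through the members: a family containing some
  \<open>t\<close> with a small first entry has few possible values in every position.\<close>

lemma schreier_plegmatic_witness:
  assumes "schreier_plegmatic kk P" "1 \<le> kk"
  shows "\<exists>F. (\<forall>t\<in>P. \<forall>i\<in>{1..kk}. el t i \<in> F i \<and> card (F i) \<le> el t 1) \<and> (\<forall>i\<in>{1..kk}. finite (F i)) \<and>
    (\<forall>i\<in>{1..<kk}. \<forall>a\<in>F i. \<forall>b\<in>F (Suc i). a < b)"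
proof -
  obtain F where F: "plegmatic_witness kk P F" "card (F 1) \<le> Min (F 1)"
    using assms(1) by (auto simp: schreier_plegmatic_def)
  have mem: "el t i \<in> F i" if "t \<in> P" "i \<in> {1..kk}" for t i
    using F(1) that by (auto simp: plegmatic_witness_def)
  have "\<forall>i\<in>{1..kk}. finite (F i) \<and> F i \<noteq> {} \<and> card (F i) = card (F 1)"
    using F(1) unfolding plegmatic_witness_def by (rule conjunct1)
  then have fin: "finite (F i)" "card (F i) = card (F 1)" if "i \<in> {1..kk}" for i
    using that by blast+
  have "card (F i) \<le> el t 1" if "t \<in> P" "i \<in> {1..kk}" for t i
  proof -
    have "card (F i) \<le> Min (F 1)"
      using fin(2)[OF that(2)] F(2) by simp
    also have "\<dots> \<le> el t 1"
      using mem[OF that(1), of 1] fin(1)[of 1] assms(2) by simp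
    finally show ?thesis .
  qed
  moreover have "\<forall>i\<in>{1..<kk}. \<forall>a\<in>F i. \<forall>b\<in>F (Suc i). a < b"
    using F(1) unfolding plegmatic_witness_def by (elim conjE)
  ultimately show ?thesis
    using mem fin(1) by (intro exI[of _ F]) simp
qed

text \<open>\<open>m\<close> is fixed before \<open>L\<close>, because a spreading model controls
  sums of length \<open>m\<close> only for families that start far enough out. The bound consists of
  c/4 * m from the gaps, c/4 * m from cancellation, and sqrt m times a constant from the structured
  coordinates. Each vector has kk * (k + 1) gap pieces, one for each entry position and each gap,
  whence the choice of \<open>\<delta>\<close>.\<close>

theorem alternating_plegma_sum_small:
  assumes k: "1 \<le> k" "k < kk" and M: "infinite M"
    and w: "\<And>s. s \<in> ksubsets M k \<Longrightarrow> w s \<in> c00 kk"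
    and C: "\<And>s. s \<in> ksubsets M k \<Longrightarrow> Xnorm kk (w s) \<le> C" and "0 < c"
  shows "\<exists>m\<ge>1. \<forall>L. \<exists>s. plegma k M m s \<and> L \<le> el (s 1) 1 \<and>
    Xnorm kk (\<lambda>t. \<Sum>j=1..m. (-1) ^ j * w (s j) t) \<le> c * real m"
proof -

  \<comment> \<open>Constants chosen independently of \<open>L\<close>\<close>
  define \<delta> where "\<delta> = c / (4 * (real kk * real (k + 1)))"
  have "0 < \<delta>"
    using \<open>0 < c\<close> k by (simp add: \<delta>_def)
  obtain Y where Y: "Y \<subseteq> M" "infinite Y"
    and gap: "\<forall>s\<in>ksubsets Y k. \<forall>z\<in>Y. \<forall>z'\<in>Y. \<forall>i\<in>{1..kk}. z < z' \<longrightarrow> s \<inter> {z..z'} = {} \<longrightarrow>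
       Xnorm kk (cutoff {t. z \<le> el t i \<and> el t i < z'} (w s)) \<le> \<delta>"
    using small_gaps[of M k w kk C \<delta>, OF M w C \<open>0 < \<delta>\<close>] by blast
  \<comment> \<open>Any element of \<open>Y\<close> can be the threshold. It is taken from
    \<open>Y\<close> because it will be the left end of the gap below the least element of each
    \<open>s\<close>, to which \<open>gap\<close> is applied.\<close>
  obtain H where H: "H \<in> Y"
    using Y(2) by (metis ex_in_conv finite.emptyI)
  define B where "B = {t \<in> ksubsets NN kk. t \<subseteq> {..<H}}"
  have B: "finite B"
    by (rule finite_subset[of _ "Pow {..<H}"]) (auto simp: B_def)
  \<comment> \<open>The coordinates in \<open>B\<close> will contribute at most N * card
    \<open>B\<close> * \<open>\<eta>\<close>, which is at most c/4 * m for m = 2 * N. The added 1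
    keeps the denominator positive when \<open>B\<close> is empty.\<close>
  define \<eta> where "\<eta> = c / (2 * (real (card B) + 1))"
  have "0 < \<eta>"
    using \<open>0 < c\<close> by (simp add: \<eta>_def)
  obtain Y' where Y': "Y' \<subseteq> {y \<in> Y. H < y}" "infinite Y'"
    and const: "\<forall>t\<in>B. \<forall>s\<in>ksubsets Y' k. \<forall>s'\<in>ksubsets Y' k. \<bar>w s t - w s' t\<bar> \<le> \<eta>"
  proof -
    have "infinite {y \<in> Y. H < y}"
    proof
      assume "finite {y \<in> Y. H < y}"
      moreover have "Y \<subseteq> {y \<in> Y. H < y} \<union> {..H}" by auto
      ultimately show False
        using Y(2) finite_subset by blast
    qed
    moreover have "\<bar>w s t\<bar> \<le> C" if "t \<in> B" "s \<in> ksubsets {y \<in> Y. H < y} k" for s t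
    proof -
      have "s \<in> ksubsets M k"
        using that(2) Y(1) ksubsets_mono[of "{y \<in> Y. H < y}" M] by blast
      then show ?thesis
        using Xnorm_ge_coord[OF w, of s t] C[of s] that(1) k by (auto simp: B_def)
    qed
    ultimately show ?thesis
      using Ramsey_almost_constant_finite[OF B, of "{y \<in> Y. H < y}" k "\<lambda>t s. w s t" C \<eta>] \<open>0 < \<eta>\<close> that
      by blast
  qed
  have Y'Y: "Y' \<subseteq> Y" and Y'M: "Y' \<subseteq> M" and Y'H: "\<And>y. y \<in> Y' \<Longrightarrow> H < y"
    using Y' Y(1) by auto
  have "0 \<le> C"
  proof -
    obtain X where "X \<subseteq> M" "finite X" "card X = k"
      using infinite_arbitrarily_large[OF M] by blast
    then have "X \<in> ksubsets M k"
      by (simp add: ksubsets_def)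
    then show ?thesis
      using Xnorm_nonneg[OF w] C by force
  qed
  \<comment> \<open>The summand sqrt \<open>H\<close> comes from \<open>E1\<close>, and kk * k
    bounds the number of pairs indexing \<open>E2\<close>. \<open>N\<close> is large enough for sqrt
    m * \<open>K\<close> \<le> c/2 * m; \<open>m\<close> is even so that signs pair off, and
    \<open>Suc\<close> makes it positive.\<close>
  define K where "K = (sqrt (real H) + real kk * real k) * C"
  define N where "N = Suc (nat \<lceil>(2 * K / c)\<^sup>2\<rceil>)"
  define m where "m = 2 * N"
  have "1 \<le> m"
    by (simp add: m_def N_def)
  have m_large: "sqrt (real m) * K \<le> c / 2 * real m"
  proof -
    have "(2 * K / c)\<^sup>2 \<le> real N"
      unfolding N_def by linarith
    also have "\<dots> \<le> real m"
      by (simp add: m_def)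
    finally have "\<bar>2 * K / c\<bar> \<le> sqrt (real m)"
      by (metis real_sqrt_abs real_sqrt_le_mono)
    then have "2 * K / c \<le> sqrt (real m)"
      by linarith
    then have "K \<le> c / 2 * sqrt (real m)"
      using \<open>0 < c\<close> by (simp add: field_simps)
    then have "sqrt (real m) * K \<le> sqrt (real m) * (c / 2 * sqrt (real m))"
      by (intro mult_left_mono) auto
    then show ?thesis
      by (simp add: mult.left_commute)
  qed
  show ?thesis
  proof (intro exI[of _ m] conjI allI \<open>1 \<le> m\<close>)
    fix L

    \<comment> \<open>The plegma family, its windows and its gaps\<close>
    define v where "v = enumerate Y'"
    have vY': "v a \<in> Y'" for a
      unfolding v_def using Y'(2) by (rule enumerate_in_set)
    have v_less: "v a < v b \<longleftrightarrow> a < b" for a b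
      unfolding v_def using Y'(2) by simp
    have v_le: "v a \<le> v b \<longleftrightarrow> a \<le> b" for a b
      by (metis v_less not_le)
    \<comment> \<open>Used positions are three apart, so each element of \<open>s j\<close> has a
      neighbour in \<open>Y'\<close> on either side that separates it from all other used elements,
      and the windows from \<open>lo\<close> to \<open>hi\<close> are disjoint. The term
      \<open>q * m + j\<close> produces the plegma order, \<open>L\<close> pushes the family far
      out, and \<open>Suc\<close> protects the later subtraction of 1.\<close>
    define p where "p = (\<lambda>q j. Suc (L + 3 * (q * m + j)))"
    define s where "s = (\<lambda>j. (\<lambda>q. v (p q j)) ` {1..k})"
    define lo where "lo = (\<lambda>q j. v (p q j - 1))"
    define hi where "hi = (\<lambda>q j. v (p q j + 1))"
    have p_mono: "p q j + 3 \<le> p q' j" if "q < q'" for q q' j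
    proof -
      have "Suc q * m \<le> q' * m"
        using that by (intro mult_right_mono) auto
      then show ?thesis
        using \<open>1 \<le> m\<close> by (simp add: p_def)
    qed
    have p_pos: "1 \<le> p q j" for q j
      by (simp add: p_def)
    have p_sep: "p q j + 3 \<le> p q' j' \<or> p q' j' + 3 \<le> p q j"
      if "j \<in> {1..m}" "j' \<in> {1..m}" "j \<noteq> j'" for q q' j j'
    proof -
      have "q * m + j \<noteq> q' * m + j'"
      proof (cases q q' rule: linorder_cases)
        case less
        then have "Suc q * m \<le> q' * m"
          by (intro mult_right_mono) auto
        then show ?thesis using that by auto
      next
        case greater
        then have "Suc q' * m \<le> q * m"
          by (intro mult_right_mono) auto
        then show ?thesis using that by auto
      qed (use that in simp)
      then show ?thesis
        unfolding p_def by (cases "q * m + j < q' * m + j'") auto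
    qed
    have smono: "strict_mono_on {1..k} (\<lambda>q. v (p q j))" for j
    proof (rule strict_mono_onI)
      fix q q' :: nat assume "q < q'"
      then show "v (p q j) < v (p q' j)"
        using p_mono[of q q' j] by (simp add: v_less)
    qed
    have els: "el (s j) q = v (p q j)" if "q \<in> {1..k}" for q j
      using el_image[OF smono] that by (simp add: s_def)
    have sY': "s j \<in> ksubsets Y' k" for j
      using vY' card_image[OF strict_mono_on_imp_inj_on[OF smono], of j]
      by (auto simp: ksubsets_def s_def)
    have sM: "s j \<in> ksubsets M k" for j
      using sY' ksubsets_mono[OF Y'M] by blast
    note wc = w[OF sM] and wC = C[OF sM]
    have plegma: "plegma k M m s"
      unfolding plegma_def
    proof (intro conjI ballI)
      fix i j assume "i \<in> {1..k}" "j \<in> {1..<m}"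
      then show "el (s j) i < el (s (Suc j)) i"
        by (simp add: els v_less p_def)
    next
      fix i assume "i \<in> {1..<k}"
      then show "el (s m) i < el (s 1) (Suc i)"
        by (simp add: els v_less p_def)
    qed (rule sM)
    have L: "L \<le> el (s 1) 1"
    proof -
      have "L \<le> p 1 1"
        by (simp add: p_def)
      also have "\<dots> \<le> v (p 1 1)"
        unfolding v_def using Y'(2) by (rule le_enumerate)
      finally show ?thesis
        using k by (simp add: els)
    qed
    \<comment> \<open>Everything that the right end \<open>Z\<close> of the last gap has to exceed:
      all entries of the supports involved, and the last windows.\<close>
    define U where "U = (\<Union>j\<in>{1..m}. \<Union>{t. w (s j) t \<noteq> 0} \<union> {hi k j})"
    have "finite U"
    proof -
      have "finite t" if "w (s j) t \<noteq> 0" for j t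
        using c00_ksubsets[OF wc that] by (simp add: ksubsets_def)
      then show ?thesis
        using c00_finite[OF wc] by (auto simp: U_def)
    qed
    then obtain Z where Z: "Z \<in> Y'" "\<And>y. y \<in> U \<Longrightarrow> y < Z"
      using Y'(2) by (metis finite_nat_set_iff_bounded infinite_nat_iff_unbounded order.strict_trans)
    \<comment> \<open>The first gap has no window to its left and the last gap none to its right;
      \<open>H\<close> and \<open>Z\<close> take their places.\<close>
    define bot where "bot = (\<lambda>q j. if q = 0 then H else hi q j)"
    define top where "top = (\<lambda>q j. if q = k then Z else lo (Suc q) j)"
    define gaps where "gaps = (\<lambda>(i, q) j. {t. bot q j \<le> el t i \<and> el t i < top q j})"
    have gap_small: "Xnorm kk (cutoff (gaps iq j) (w (s j))) \<le> \<delta>"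
      if iq: "iq \<in> {1..kk} \<times> {0..k}" and j: "j \<in> {1..m}" for iq j
    proof -
      obtain i q where [simp]: "iq = (i, q)" by (cases iq)
      have q: "q \<le> k" "i \<in> {1..kk}" using iq by auto
      have "bot q j \<in> Y" "top q j \<in> Y"
        using H Z(1) vY' Y'Y by (auto simp: bot_def top_def hi_def lo_def)
      moreover have "bot q j < top q j"
      proof -
        have "hi k j < Z"
          using j by (intro Z(2)) (auto simp: U_def)
        moreover have "H < Z" "H < lo (Suc 0) j"
          using Y'H Z(1) vY' by (auto simp: lo_def)
        moreover have "hi q j < lo (Suc q) j"
          using p_mono[of q "Suc q" j] by (simp add: hi_def lo_def v_less)
        ultimately show ?thesis
          by (simp add: bot_def top_def)
      qed
      moreover have "s j \<inter> {bot q j..top q j} = {}"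
      proof -
        have "v (p q' j) < bot q j \<or> top q j < v (p q' j)" if "q' \<in> {1..k}" for q'
        proof (cases "q' \<le> q")
          case True
          then have "p q' j \<le> p q j"
            using p_mono[of q' q j] by (cases "q' = q") auto
          then show ?thesis
            using True that by (simp add: bot_def hi_def v_less)
        next
          case False
          then have "p (Suc q) j \<le> p q' j"
            using p_mono[of "Suc q" q' j] by (cases "q' = Suc q") auto
          then have "p (Suc q) j - 1 < p q' j"
            using p_pos[of "Suc q" j] by linarith
          then show ?thesis
            using False that by (simp add: top_def lo_def v_less)
        qed
        then show ?thesis
          by (fastforce simp: s_def)
      qed
      ultimately show ?thesis
        using gap[rule_format, of "s j" "bot q j" "top q j" i] sY' ksubsets_mono[OF Y'Y] q
        by (auto simp: gaps_def)
    qed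
    \<comment> \<open>These are the coordinates that remain and are handled by counting: mixed ones,
      limited by the Schreier condition, and ones with two consecutive entries in the same window,
      limited by the order of the blocks of a plegmatic family.\<close>
    define E1 where "E1 = (\<lambda>j. {t. el t 1 < H \<and> (\<exists>q\<in>{1..k}. lo q j \<le> el t kk \<and> el t kk < hi q j)})"
    define E2 where "E2 = (\<lambda>(i, q) j. {t. lo q j \<le> el t i \<and> el t (Suc i) < hi q j})"
    have cover: "t \<in> E1 j \<or> (\<exists>iq\<in>{1..kk} \<times> {0..k}. t \<in> gaps iq j) \<or>
        (\<exists>iq\<in>{1..<kk} \<times> {1..k}. t \<in> E2 iq j)"
      if t: "w (s j) t \<noteq> 0" "t \<notin> B" and j: "j \<in> {1..m}" for t j
    proof (rule ccontr)
      assume neg: "\<not> ?thesis"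
      have tk: "t \<in> ksubsets NN kk"
        using c00_ksubsets[OF wc t(1)] .
      then have t': "finite t" "card t = kk"
        by (auto simp: ksubsets_def)
      have near: "\<exists>q\<in>{1..k}. lo q j \<le> el t i \<and> el t i < hi q j"
        if i: "i \<in> {1..kk}" and "H \<le> el t i" for i
      proof -
        \<comment> \<open>The last gap that starts at or below the entry. The entry is not in this
          gap, so it has passed its right end, and it precedes the next gap: it lies in the window
          between them.\<close>
        define q where "q = Max {q \<in> {0..k}. bot q j \<le> el t i}"
        have fin: "finite {q \<in> {0..k}. bot q j \<le> el t i}" by simp
        have "0 \<in> {q \<in> {0..k}. bot q j \<le> el t i}"
          using \<open>H \<le> el t i\<close> by (simp add: bot_def)
        then have "q \<in> {q \<in> {0..k}. bot q j \<le> el t i}"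
          unfolding q_def using fin by (intro Max_in) auto
        then have q: "q \<le> k" "bot q j \<le> el t i" by auto
        have "t \<notin> gaps (i, q) j"
          using neg i q by auto
        then have "top q j \<le> el t i"
          using q by (auto simp: gaps_def)
        have "el t i \<in> U"
          using t(1) j i t' el_mem[of t i] by (auto simp: U_def)
        then have "el t i < Z"
          by (rule Z(2))
        then have "q < k" "lo (Suc q) j \<le> el t i"
          using \<open>top q j \<le> el t i\<close> q by (auto simp: top_def split: if_splits)
        moreover have "\<not> bot (Suc q) j \<le> el t i"
        proof
          assume "bot (Suc q) j \<le> el t i"
          then have "Suc q \<le> q"
            unfolding q_def using \<open>q < k\<close> by (intro Max_ge[OF fin]) (auto simp: q_def)
          then show False by simp
        qed
        ultimately show ?thesis
          by (intro bexI[of _ "Suc q"]) (auto simp: bot_def)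
      qed
      show False
      proof (cases "el t 1 < H")
        case True
        have "\<exists>y\<in>t. H \<le> y"
          using t(2) tk by (force simp: B_def)
        then obtain i where "i \<in> {1..kk}" "H \<le> el t i"
          using el_image_eq[OF t'(1)] t'(2) by force
        then have "H \<le> el t kk"
          using el_mono[OF t'(1), of i kk] t'(2) by auto
        then have "t \<in> E1 j"
          using near[of kk] True k by (auto simp: E1_def)
        then show False
          using neg by blast
      next
        case False
        have "H \<le> el t i" if "i \<in> {1..kk}" for i
          using el_mono[OF t'(1), of 1 i] t'(2) that False by auto
        then obtain g where g: "\<And>i. i \<in> {1..kk} \<Longrightarrow> g i \<in> {1..k} \<and> lo (g i) j \<le> el t i \<and> el t i < hi (g i) j"
          using near by metis
        then have "g ` {1..kk} \<subseteq> {1..k}"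
          by blast
        \<comment> \<open>The \<open>kk\<close> entries fall into \<open>k < kk\<close> windows, so
          two of them share a window. Entry i + 1 is at most the larger one, hence it stays in that
          window.\<close>
        then have "\<not> inj_on g {1..kk}"
          using card_inj_on_le[of g "{1..kk}" "{1..k}"] k by auto
        then obtain i i' where i: "i \<in> {1..kk}" "i' \<in> {1..kk}" "i < i'" "g i = g i'"
          unfolding inj_on_def by (metis linorder_neqE_nat)
        have "el t (Suc i) \<le> el t i'"
          using el_mono[OF t'(1), of "Suc i" i'] i t'(2) by auto
        then have "t \<in> E2 (i, g i) j"
          using g[of i] g[of i'] i by (auto simp: E2_def)
        moreover have "(i, g i) \<in> {1..<kk} \<times> {1..k}"
          using i g[of i] by auto
        ultimately show False
          using neg by blast
      qed
    qed

    \<comment> \<open>Counting the members that a Schreier plegmatic family meets\<close>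
    have meet1: "card {j \<in> {1..m}. \<exists>t\<in>P. \<bar>cutoff (E1 j) (w (s j)) t\<bar> \<noteq> 0} \<le> H"
      if P: "schreier_plegmatic kk P" for P
    proof -
      define J where "J = {j \<in> {1..m}. \<exists>t\<in>P. \<bar>cutoff (E1 j) (w (s j)) t\<bar> \<noteq> 0}"
      obtain F where F: "\<forall>t\<in>P. \<forall>i\<in>{1..kk}. el t i \<in> F i \<and> card (F i) \<le> el t 1" "\<forall>i\<in>{1..kk}. finite (F i)"
        using schreier_plegmatic_witness[OF P] k by auto
      have "\<forall>j\<in>J. \<exists>t. t \<in> P \<and> t \<in> E1 j"
        by (auto simp: J_def cutoff_def split: if_splits)
      from bchoice[OF this] obtain T where T: "\<And>j. j \<in> J \<Longrightarrow> T j \<in> P \<and> T j \<in> E1 j"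
        by blast
      \<comment> \<open>Windows of different members are disjoint, so the last entry of
        \<open>T j\<close> determines \<open>j\<close>. All last entries lie in \<open>F kk\<close>,
        whose size is at most a first entry and hence below \<open>H\<close>.\<close>
      have "inj_on (\<lambda>j. el (T j) kk) J"
      proof (rule inj_onI, rule ccontr)
        fix j j' assume j: "j \<in> J" "j' \<in> J" "el (T j) kk = el (T j') kk" "j \<noteq> j'"
        obtain q where q: "lo q j \<le> el (T j) kk" "el (T j) kk < hi q j"
          using T[OF j(1)] by (auto simp: E1_def)
        obtain q' where q': "lo q' j' \<le> el (T j') kk" "el (T j') kk < hi q' j'"
          using T[OF j(2)] by (auto simp: E1_def)
        have "p q j + 3 \<le> p q' j' \<or> p q' j' + 3 \<le> p q j"
          using j by (intro p_sep) (auto simp: J_def)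
        then have "hi q j \<le> lo q' j' \<or> hi q' j' \<le> lo q j"
          unfolding hi_def lo_def v_le by linarith
        then show False
          using q q' j(3) by linarith
      qed
      moreover have "(\<lambda>j. el (T j) kk) ` J \<subseteq> F kk"
        using T F(1) k by force
      ultimately have card: "card J \<le> card (F kk)"
        using F(2) k by (intro card_inj_on_le) auto
      have "card J \<le> H"
      proof (cases "J = {}")
        case False
        then obtain j where "j \<in> J" by blast
        then have "el (T j) 1 < H" "card (F kk) \<le> el (T j) 1"
          using T[of j] F(1) k by (auto simp: E1_def)
        then show ?thesis
          using card by linarith
      qed simp
      then show ?thesis
        by (simp add: J_def)
    qed
    have meet2: "card {j \<in> {1..m}. \<exists>t\<in>P. \<bar>cutoff (E2 iq j) (w (s j)) t\<bar> \<noteq> 0} \<le> 1"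
      if P: "schreier_plegmatic kk P" and iq: "iq \<in> {1..<kk} \<times> {1..k}" for P iq
    proof -
      define J where "J = {j \<in> {1..m}. \<exists>t\<in>P. \<bar>cutoff (E2 iq j) (w (s j)) t\<bar> \<noteq> 0}"
      obtain i q where iq_eq: "iq = (i, q)" by (cases iq)
      have i: "i \<in> {1..<kk}" using iq iq_eq by auto
      obtain F where F: "\<forall>t\<in>P. \<forall>i\<in>{1..kk}. el t i \<in> F i"
          "\<forall>i\<in>{1..<kk}. \<forall>a\<in>F i. \<forall>b\<in>F (Suc i). a < b"
        using schreier_plegmatic_witness[OF P] k by auto
      \<comment> \<open>For j < j' the window of \<open>j\<close> lies below that of
        \<open>j'\<close>. So an entry i + 1 coming from \<open>j\<close> would be smaller than an
        entry i coming from \<open>j'\<close>, although \<open>F i\<close> precedes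
        \<open>F (Suc i)\<close>.\<close>
      have "False" if jJ: "j \<in> J" "j' \<in> J" and "j < j'" for j j'
      proof -
        obtain t where t: "t \<in> P" "el t (Suc i) < hi q j"
          using jJ(1) by (auto simp: J_def cutoff_def E2_def iq_eq split: if_splits)
        obtain t' where t': "t' \<in> P" "lo q j' \<le> el t' i"
          using jJ(2) by (auto simp: J_def cutoff_def E2_def iq_eq split: if_splits)
        have "hi q j \<le> lo q j'"
          using \<open>j < j'\<close> unfolding hi_def lo_def v_le p_def by simp
        then have "el t (Suc i) < el t' i"
          using t t' by linarith
        moreover have "el t' i < el t (Suc i)"
          using F t(1) t'(1) i by simp
        ultimately show False by simp
      qed
      then have "j = j'" if "j \<in> J" "j' \<in> J" for j j'
        using that by (cases j j' rule: linorder_cases) blast+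
      moreover have "finite J"
        by (simp add: J_def)
      ultimately have "card J \<le> Suc 0"
        using card_le_Suc0_iff_eq by blast
      then show ?thesis
        by (simp add: J_def)
    qed

    \<comment> \<open>Norm estimates for the four parts\<close>
    define T0 where "T0 = cutoff B (\<lambda>t. \<Sum>j=1..m. (-1) ^ j * w (s j) t)"
    \<comment> \<open>Only \<open>T0\<close> keeps the signs, as cancellation is used on
      \<open>B\<close> alone. The other parts sum absolute values, so the covering sets may
      overlap.\<close>
    define T1 where "T1 = (\<lambda>t. \<Sum>j=1..m. \<Sum>iq\<in>{1..kk} \<times> {0..k}. \<bar>cutoff (gaps iq j) (w (s j)) t\<bar>)"
    define T2 where "T2 = (\<lambda>t. \<Sum>j=1..m. \<bar>cutoff (E1 j) (w (s j)) t\<bar>)"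
    define T3 where "T3 = (\<lambda>t. \<Sum>iq\<in>{1..<kk} \<times> {1..k}. \<Sum>j=1..m. \<bar>cutoff (E2 iq j) (w (s j)) t\<bar>)"
    have abs_c00: "(\<lambda>t. \<bar>x t\<bar>) \<in> c00 kk" if "x \<in> c00 kk" for x
      using that by (rule c00_dominated) simp
    have abs_Xnorm: "Xnorm kk (\<lambda>t. \<bar>x t\<bar>) = Xnorm kk x" if "x \<in> c00 kk" for x
      using Xnorm_abs_cong[OF that, of "\<lambda>t. \<bar>x t\<bar>"] by simp
    note cs = c00_sum abs_c00 c00_cutoff wc c00_cmult
    have T_c00: "T0 \<in> c00 kk" "T1 \<in> c00 kk" "T2 \<in> c00 kk" "T3 \<in> c00 kk"
      unfolding T0_def T1_def T2_def T3_def by (intro cs)+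
    have nT0: "Xnorm kk T0 \<le> c / 4 * real m"
    proof -
      have "Xnorm kk T0 \<le> (\<Sum>t\<in>B. \<bar>T0 t\<bar>)"
        by (rule Xnorm_le_sum[OF T_c00(1) B]) (simp add: T0_def cutoff_def)
      also have "\<dots> \<le> (\<Sum>t\<in>B. real N * \<eta>)"
      proof (rule sum_mono)
        fix t assume "t \<in> B"
        then have "\<bar>\<Sum>j=1..2 * N. (-1) ^ j * w (s j) t\<bar> \<le> real N * \<eta>"
          using const sY' by (intro alternating_sum_bound) auto
        then show "\<bar>T0 t\<bar> \<le> real N * \<eta>"
          using \<open>t \<in> B\<close> by (simp add: T0_def cutoff_def m_def)
      qed
      also have "\<dots> = real N * (real (card B) * \<eta>)"
        by simp
      also have "\<dots> \<le> real N * (c / 2)"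
        using \<open>0 < c\<close> by (intro mult_left_mono) (auto simp: \<eta>_def field_simps)
      finally show ?thesis
        by (simp add: m_def mult.commute)
    qed
    have nT1: "Xnorm kk T1 \<le> c / 4 * real m"
    proof -
      have "Xnorm kk T1 \<le> (\<Sum>j=1..m. \<Sum>iq\<in>{1..kk} \<times> {0..k}. \<delta>)"
        unfolding T1_def
        by (intro order_trans[OF Xnorm_sum] sum_mono cs)
          (use gap_small abs_Xnorm[OF c00_cutoff[OF wc]] in auto)
      also have "\<dots> = real m * (real kk * real (k + 1) * \<delta>)"
        by (simp add: algebra_simps)
      also have "real kk * real (k + 1) * \<delta> = c / 4"
        using k by (simp add: \<delta>_def del: of_nat_add)
      finally show ?thesis by (simp add: mult.commute)
    qed
    have nT2: "Xnorm kk T2 \<le> sqrt (real H * real m) * C"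
      using Xnorm_upper_2_estimate[of "{1..m}" "\<lambda>j t. \<bar>cutoff (E1 j) (w (s j)) t\<bar>" kk C H]
        meet1 abs_Xnorm[OF c00_cutoff[OF wc]] order_trans[OF Xnorm_cutoff_le[OF wc] wC]
        abs_c00[OF c00_cutoff[OF wc]]
      by (simp add: T2_def)
    have nT3: "Xnorm kk T3 \<le> real kk * real k * (sqrt (real m) * C)"
    proof -
      have row: "Xnorm kk (\<lambda>t. \<Sum>j=1..m. \<bar>cutoff (E2 iq j) (w (s j)) t\<bar>) \<le> sqrt (real m) * C"
        if "iq \<in> {1..<kk} \<times> {1..k}" for iq
        using Xnorm_upper_2_estimate[of "{1..m}" "\<lambda>j t. \<bar>cutoff (E2 iq j) (w (s j)) t\<bar>" kk C 1]
          meet2[OF _ that] abs_Xnorm[OF c00_cutoff[OF wc]] order_trans[OF Xnorm_cutoff_le[OF wc] wC]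
          abs_c00[OF c00_cutoff[OF wc]]
        by simp
      have "Xnorm kk T3 \<le> (\<Sum>iq\<in>{1..<kk} \<times> {1..k}. Xnorm kk (\<lambda>t. \<Sum>j=1..m. \<bar>cutoff (E2 iq j) (w (s j)) t\<bar>))"
        unfolding T3_def by (intro Xnorm_sum cs)
      also have "\<dots> \<le> (\<Sum>iq\<in>{1..<kk} \<times> {1..k}. sqrt (real m) * C)"
        by (intro sum_mono row)
      also have "\<dots> = real (kk - 1) * real k * (sqrt (real m) * C)"
        by simp
      also have "\<dots> \<le> real kk * real k * (sqrt (real m) * C)"
        using \<open>0 \<le> C\<close> by (intro mult_right_mono) auto
      finally show ?thesis .
    qed
    have "Xnorm kk (\<lambda>t. \<Sum>j=1..m. (-1) ^ j * w (s j) t)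
        \<le> Xnorm kk (\<lambda>t. \<bar>T0 t\<bar> + T1 t + T2 t + T3 t)"
    proof (rule Xnorm_mono)
      fix t
      have T_nonneg: "0 \<le> T1 t" "0 \<le> T2 t" "0 \<le> T3 t"
        by (auto simp: T1_def T2_def T3_def intro!: sum_nonneg)
      have "\<bar>\<Sum>j=1..m. (-1) ^ j * w (s j) t\<bar> \<le> \<bar>T0 t\<bar> + T1 t + T2 t + T3 t"
      proof (cases "t \<in> B")
        case True
        then show ?thesis
          using T_nonneg by (simp add: T0_def cutoff_def)
      next
        case False
        define G1 where "G1 = (\<lambda>j. \<Sum>iq\<in>{1..kk} \<times> {0..k}. \<bar>cutoff (gaps iq j) (w (s j)) t\<bar>)"
        define G2 where "G2 = (\<lambda>j. \<bar>cutoff (E1 j) (w (s j)) t\<bar>)"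
        define G3 where "G3 = (\<lambda>j. \<Sum>iq\<in>{1..<kk} \<times> {1..k}. \<bar>cutoff (E2 iq j) (w (s j)) t\<bar>)"
        have G_nonneg: "0 \<le> G1 j" "0 \<le> G2 j" "0 \<le> G3 j" for j
          by (auto simp: G1_def G2_def G3_def intro!: sum_nonneg)
        have "\<bar>w (s j) t\<bar> \<le> G1 j + G2 j + G3 j" if j: "j \<in> {1..m}" for j
        proof (cases "w (s j) t = 0")
          case nz: False
          consider "t \<in> E1 j" | iq where "iq \<in> {1..kk} \<times> {0..k}" "t \<in> gaps iq j"
            | iq where "iq \<in> {1..<kk} \<times> {1..k}" "t \<in> E2 iq j"
            using cover[OF nz False j] by blast
          then show ?thesis
          proof cases
            case 1
            then show ?thesis
              using G_nonneg[of j] by (simp add: G2_def cutoff_def)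
          next
            case 2
            have "\<bar>cutoff (gaps iq j) (w (s j)) t\<bar> \<le> G1 j"
              unfolding G1_def by (rule member_le_sum[OF 2(1)]) auto
            then show ?thesis
              using 2(2) G_nonneg[of j] by (simp add: cutoff_def)
          next
            case 3
            have "\<bar>cutoff (E2 iq j) (w (s j)) t\<bar> \<le> G3 j"
              unfolding G3_def by (rule member_le_sum[OF 3(1)]) auto
            then show ?thesis
              using 3(2) G_nonneg[of j] by (simp add: cutoff_def)
          qed
        qed (use G_nonneg[of j] in simp)
        then have "(\<Sum>j=1..m. \<bar>w (s j) t\<bar>) \<le> (\<Sum>j=1..m. G1 j + G2 j + G3 j)"
          by (rule sum_mono)
        also have "\<dots> = T1 t + T2 t + T3 t"
          unfolding T1_def T2_def T3_def G1_def G2_def G3_def sum.distrib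
          by (subst (3) sum.swap) simp
        finally have "(\<Sum>j=1..m. \<bar>w (s j) t\<bar>) \<le> T1 t + T2 t + T3 t" .
        moreover have "\<bar>\<Sum>j=1..m. (-1) ^ j * w (s j) t\<bar> \<le> (\<Sum>j=1..m. \<bar>w (s j) t\<bar>)"
          by (rule order_trans[OF sum_abs]) (simp add: abs_mult power_abs)
        ultimately show ?thesis by simp
      qed
      then show "\<bar>\<Sum>j=1..m. (-1) ^ j * w (s j) t\<bar> \<le> \<bar>\<bar>T0 t\<bar> + T1 t + T2 t + T3 t\<bar>"
        by linarith
    qed (intro c00_add abs_c00 T_c00)
    also have "\<dots> \<le> Xnorm kk T0 + Xnorm kk T1 + Xnorm kk T2 + Xnorm kk T3"
      unfolding abs_Xnorm[OF T_c00(1), symmetric]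
      by (intro order_trans[OF Xnorm_add] add_mono order_refl c00_add abs_c00 T_c00)
    also have "\<dots> \<le> c / 4 * real m + c / 4 * real m + sqrt (real H * real m) * C
        + real kk * real k * (sqrt (real m) * C)"
      by (intro add_mono nT0 nT1 nT2 nT3)
    also have "\<dots> = c / 2 * real m + sqrt (real m) * K"
      by (simp add: K_def real_sqrt_mult algebra_simps)
    also have "\<dots> \<le> c * real m"
      using m_large by simp
    finally show "\<exists>s. plegma k M m s \<and> L \<le> el (s 1) 1 \<and>
        Xnorm kk (\<lambda>t. \<Sum>j=1..m. (-1) ^ j * w (s j) t) \<le> c * real m"
      using plegma L by blast
  qed
qed

subsection \<open>Plegma families are plegmatic\<close>

text \<open>\<open>enumerate\<close> counts from 0 while \<open>NN\<close> starts at 1. In terms of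
  \<open>elM\<close> this says M(l) \<ge> l, which links the starting condition of spreading models
  to the Schreier condition.\<close>

lemma enumerate_ge_Suc:
  assumes "infinite M" "M \<subseteq> NN"
  shows "Suc n \<le> enumerate M n"
proof (induction n)
  case 0
  show ?case
    using enumerate_in_set[OF assms(1), of 0] assms(2) by (auto simp: NN_def)
next
  case (Suc n)
  then show ?case
    using enumerate_step[OF assms(1), of n] by linarith
qed

lemma plegma_less:
  assumes "plegma k M m s" "1 \<le> i" "i \<le> k" "1 \<le> a" "a < b" "b \<le> m"
  shows "el (s a) i < el (s b) i"
  using assms(5,6)
proof (induction b)
  case (Suc b)
  have "el (s b) i < el (s (Suc b)) i" if "1 \<le> b"
    using assms(1-3) Suc.prems that by (auto simp: plegma_def)
  then show ?case
    using Suc assms(4) by (cases "a = b") auto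
qed simp

lemma plegma_inj_on:
  assumes "plegma k M m s" "1 \<le> i" "i \<le> k"
  shows "inj_on (\<lambda>a. el (s a) i) {1..m}"
proof (rule linorder_inj_onI)
  fix a b assume "a < b" "a \<in> {1..m}" "b \<in> {1..m}"
  then show "el (s a) i \<noteq> el (s b) i"
    using plegma_less[OF assms, of a b] by auto
qed auto

text \<open>The i-th block collects the i-th entries of all members. It has exactly \<open>m\<close>
  elements because these entries increase strictly along the family, and the plegma condition
  separates successive blocks; \<open>m \<le> el (s 1) 1\<close> becomes the Schreier
  condition.\<close>

lemma plegma_schreier_plegmatic:
  assumes pl: "plegma k M m s" and M: "M \<subseteq> NN" and k: "1 \<le> k" and m: "1 \<le> m" "m \<le> el (s 1) 1"
  shows "schreier_plegmatic k (s ` {1..m})"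
proof -
  define F where "F = (\<lambda>i. (\<lambda>a. el (s a) i) ` {1..m})"
  have "el (s 1) i \<le> el (s a) i" "el (s a) i \<le> el (s m) i" if "i \<in> {1..k}" "a \<in> {1..m}" for i a
    using plegma_less[OF pl, of i 1 a] plegma_less[OF pl, of i a m] that
    by (cases "a = 1"; cases "a = m"; force)+
  note le = this
  have "plegmatic_witness k (s ` {1..m}) F"
    unfolding plegmatic_witness_def
  proof (intro conjI ballI)
    have card: "card (F i) = m" if "i \<in> {1..k}" for i
      using card_image[OF plegma_inj_on[OF pl]] that by (auto simp: F_def)
    show "finite (F i)" "F i \<noteq> {}" for i
      using m by (auto simp: F_def)
    show "card (F i) = card (F 1)" if "i \<in> {1..k}" for i
      using card[OF that] card[of 1] k by simp
    show "a < b" if i: "i \<in> {1..<k}" and a: "a \<in> F i" and b: "b \<in> F (Suc i)" for i a b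
    proof -
      obtain p q where "p \<in> {1..m}" "a = el (s p) i" "q \<in> {1..m}" "b = el (s q) (Suc i)"
        using a b by (auto simp: F_def)
      moreover have "el (s m) i < el (s 1) (Suc i)"
        using pl i by (simp add: plegma_def)
      ultimately show ?thesis
        using le(2)[of i p] le(1)[of "Suc i" q] i by auto
    qed
    show "s ` {1..m} \<subseteq> {t \<in> ksubsets NN k. \<forall>i\<in>{1..k}. el t i \<in> F i}"
      using pl ksubsets_mono[OF M] by (auto simp: plegma_def F_def)
  qed
  moreover have "card (F 1) \<le> Min (F 1)"
  proof -
    have "card (F 1) \<le> m"
      using card_image_le[of "{1..m}"] by (simp add: F_def)
    also have "m \<le> Min (F 1)"
      using m k le(1)[of 1] by (subst Min_ge_iff) (force simp: F_def)+
    finally show ?thesis .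
  qed
  ultimately show ?thesis
    by (auto simp: schreier_plegmatic_def)
qed

subsection \<open>The completion and its basis\<close>

locale completion =
  fixes kk :: nat and j :: "(nat set \<Rightarrow> real) \<Rightarrow> 'a::banach"
  assumes kk: "1 \<le> kk" and completion_map: "is_completion_map kk j"
begin

abbreviation I :: "nat set set" where "I \<equiv> ksubsets NN kk"

abbreviation e :: "nat set \<Rightarrow> 'a" where "e s \<equiv> j (unitvec s)"

lemma j_add: "x \<in> c00 kk \<Longrightarrow> y \<in> c00 kk \<Longrightarrow> j (\<lambda>t. x t + y t) = j x + j y"
  and j_cmult: "x \<in> c00 kk \<Longrightarrow> j (\<lambda>t. c * x t) = c *\<^sub>R j x"
  and norm_j: "x \<in> c00 kk \<Longrightarrow> norm (j x) = Xnorm kk x"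
  and dense: "closure (j ` c00 kk) = UNIV"
  using completion_map by (auto simp: is_completion_map_def)

lemma j_diff:
  assumes "x \<in> c00 kk" "y \<in> c00 kk"
  shows "j (\<lambda>t. x t - y t) = j x - j y"
  using j_add[OF assms(1) c00_cmult[OF assms(2), of "-1"]] j_cmult[OF assms(2), of "-1"] by simp

lemma j_sum:
  "(\<And>i. i \<in> A \<Longrightarrow> x i \<in> c00 kk) \<Longrightarrow> j (\<lambda>t. \<Sum>i\<in>A. x i t) = (\<Sum>i\<in>A. j (x i))"
proof (induction A rule: infinite_finite_induct)
  case (insert i A)
  then have "j (\<lambda>t. x i t + (\<Sum>i\<in>A. x i t)) = j (x i) + j (\<lambda>t. \<Sum>i\<in>A. x i t)"
    by (intro j_add c00_sum) auto
  then show ?case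
    using insert by simp
qed (use j_cmult[OF c00_zero, of 0] in auto)

lemma j_expand:
  assumes "finite A" "A \<subseteq> I" "\<And>t. t \<notin> A \<Longrightarrow> x t = 0"
  shows "j x = (\<Sum>t\<in>A. x t *\<^sub>R e t)" and "x \<in> c00 kk"
proof -
  have x: "x = (\<lambda>u. \<Sum>t\<in>A. x t * unitvec t u)"
  proof
    fix u
    have "(\<Sum>t\<in>A. x t * unitvec t u) = (\<Sum>t\<in>A. if t = u then x t else 0)"
      by (intro sum.cong) (auto simp: unitvec_def)
    then show "x u = (\<Sum>t\<in>A. x t * unitvec t u)"
      using assms by simp
  qed
  have u: "unitvec t \<in> c00 kk" if "t \<in> A" for t
    using that assms(2) by (intro c00_unitvec) auto
  show "x \<in> c00 kk"
    by (subst x) (intro c00_sum c00_cmult u)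
  show "j x = (\<Sum>t\<in>A. x t *\<^sub>R e t)"
    by (subst x) (use u in \<open>simp add: j_sum c00_cmult j_cmult\<close>)
qed

lemma norm_e: "t \<in> I \<Longrightarrow> norm (e t) = 1"
  using Xnorm_unitvec[OF _ kk] by (simp add: norm_j c00_unitvec)

lemma dense_induct:
  assumes "closed {y. P y}" "\<And>x. x \<in> c00 kk \<Longrightarrow> P (j x)"
  shows "P y"
proof -
  have "closure (j ` c00 kk) \<subseteq> {y. P y}"
    using assms by (intro closure_minimal) auto
  then show ?thesis
    using dense by auto
qed

lemma approx:
  assumes "0 < \<epsilon>"
  obtains x where "x \<in> c00 kk" "norm (y - j x) < \<epsilon>"
proof -
  have "y \<in> closure (j ` c00 kk)"
    by (simp add: dense)
  then obtain x where "x \<in> c00 kk" "dist (j x) y < \<epsilon>"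
    unfolding closure_approachable using assms by blast
  then show ?thesis
    by (intro that) (auto simp: dist_norm norm_minus_commute)
qed

lemma coord_diff_le:
  assumes "x \<in> c00 kk" "y \<in> c00 kk" "t \<in> I"
  shows "\<bar>x t - y t\<bar> \<le> norm (j x - j y)"
  using Xnorm_ge_coord[OF c00_diff[OF assms(1,2)] assms(3) kk] assms
  by (simp add: norm_j[symmetric] c00_diff j_diff)

lemma inj_j: "inj_on j (c00 kk)"
proof (intro inj_onI ext)
  fix x y t assume *: "x \<in> c00 kk" "y \<in> c00 kk" "j x = j y"
  show "x t = y t"
  proof (cases "t \<in> I")
    case True
    then show ?thesis
      using coord_diff_le[OF *(1,2)] *(3) by simp
  next
    case False
    then show ?thesis
      using *(1,2)[THEN c00_ksubsets, of t] by metis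
  qed
qed

text \<open>On the dense image of \<open>c00\<close> a coordinate is 1-Lipschitz, because the norm
  dominates it, so it extends by uniform continuity. Linearity and the norm bound pass to the
  limit.\<close>

lemma coord_exists:
  assumes t: "t \<in> I"
  shows "\<exists>f :: 'a \<Rightarrow>\<^sub>L real. \<forall>x\<in>c00 kk. f (j x) = x t"
proof -
  define g where "g = (\<lambda>y. inv_into (c00 kk) j y t)"
  have g: "g (j x) = x t" if "x \<in> c00 kk" for x
    using inv_into_f_f[OF inj_j that] by (simp add: g_def)
  have uc: "uniformly_continuous_on (j ` c00 kk) g"
    unfolding uniformly_continuous_on_def
  proof (intro allI impI)
    fix \<epsilon> :: real assume "0 < \<epsilon>"
    have "dist (g y') (g y) < \<epsilon>" if "y \<in> j ` c00 kk" "y' \<in> j ` c00 kk" "dist y' y < \<epsilon>" for y y'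
      using that coord_diff_le[OF _ _ t] by (fastforce simp: g dist_norm)
    then show "\<exists>d>0. \<forall>x\<in>j ` c00 kk. \<forall>x'\<in>j ` c00 kk. dist x' x < d \<longrightarrow> dist (g x') (g x) < \<epsilon>"
      using \<open>0 < \<epsilon>\<close> by blast
  qed
  obtain h where h: "uniformly_continuous_on UNIV h" "\<And>y. y \<in> j ` c00 kk \<Longrightarrow> g y = h y"
  proof (rule uniformly_continuous_on_extension_on_closure[OF uc])
    fix h assume "uniformly_continuous_on (closure (j ` c00 kk)) h" "\<And>y. y \<in> j ` c00 kk \<Longrightarrow> g y = h y"
    then show thesis
      by (intro that) (auto simp: dense)
  qed
  have hj: "h (j x) = x t" if "x \<in> c00 kk" for x
    using h(2) g that by force
  have cont: "continuous_on A h" for A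
    using uniformly_continuous_imp_continuous[OF h(1)] continuous_on_subset by blast
  have cont2: "continuous_on UNIV (\<lambda>y. h (F y))" if "continuous_on UNIV F" for F
    using continuous_on_compose2[OF cont[of UNIV] that] by simp
  have "h (y + z) = h y + h z" for y z
  proof -
    have "h (j x + z) = h (j x) + h z" if x: "x \<in> c00 kk" for x
    proof (rule dense_induct[of "\<lambda>z. h (j x + z) = h (j x) + h z"])
      show "closed {z. h (j x + z) = h (j x) + h z}"
        by (intro closed_Collect_eq cont2 continuous_intros)
      show "h (j x + j x') = h (j x) + h (j x')" if "x' \<in> c00 kk" for x'
        using hj[OF c00_add[OF x that]] by (simp add: hj x that j_add)
    qed
    moreover have "closed {y. h (y + z) = h y + h z}"
      by (intro closed_Collect_eq cont2 continuous_intros)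
    ultimately show ?thesis
      using dense_induct[of "\<lambda>y. h (y + z) = h y + h z"] by blast
  qed
  moreover have "h (r *\<^sub>R y) = r *\<^sub>R h y" for r y
  proof (rule dense_induct[of "\<lambda>y. h (r *\<^sub>R y) = r *\<^sub>R h y"])
    show "closed {y. h (r *\<^sub>R y) = r *\<^sub>R h y}"
      by (intro closed_Collect_eq cont2 continuous_intros)
    show "h (r *\<^sub>R j x) = r *\<^sub>R h (j x)" if "x \<in> c00 kk" for x
      using hj[OF c00_cmult[OF that, of r]] by (simp add: hj that j_cmult)
  qed
  moreover have "norm (h y) \<le> norm y * 1" for y
  proof (rule dense_induct[of "\<lambda>y. norm (h y) \<le> norm y * 1"])
    show "closed {y. norm (h y) \<le> norm y * 1}"
      by (intro closed_Collect_le cont2 continuous_intros)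
    show "norm (h (j x)) \<le> norm (j x) * 1" if "x \<in> c00 kk" for x
      using Xnorm_ge_coord[OF that t kk] by (simp add: hj norm_j that)
  qed
  ultimately have "bounded_linear h"
    by (rule bounded_linear_intro)
  then show ?thesis
    using hj by (intro exI[of _ "Blinfun h"]) (simp add: bounded_linear_Blinfun_apply)
qed

definition coord :: "nat set \<Rightarrow> 'a \<Rightarrow>\<^sub>L real" where
  "coord t = (SOME f. \<forall>x\<in>c00 kk. blinfun_apply f (j x) = x t)"

lemma coord_j: "t \<in> I \<Longrightarrow> x \<in> c00 kk \<Longrightarrow> coord t (j x) = x t"
  using someI_ex[OF coord_exists, of t] by (simp add: coord_def)

definition proj :: "nat set set \<Rightarrow> 'a \<Rightarrow> 'a" where
  "proj A y = (\<Sum>t\<in>A. coord t y *\<^sub>R e t)"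

lemma proj_diff: "proj A (y - z) = proj A y - proj A z"
  by (simp add: proj_def blinfun.diff_right scaleR_diff_left sum_subtractf)

lemma continuous_proj: "continuous_on UNIV (proj A)"
  unfolding proj_def by (intro continuous_intros)

lemma proj_j:
  assumes "finite A" "A \<subseteq> I" "x \<in> c00 kk"
  shows "proj A (j x) = j (cutoff A x)"
proof -
  have "j (cutoff A x) = (\<Sum>t\<in>A. cutoff A x t *\<^sub>R e t)"
    by (rule j_expand[OF assms(1,2)]) (simp add: cutoff_def)
  also have "\<dots> = proj A (j x)"
    unfolding proj_def using assms by (intro sum.cong) (auto simp: cutoff_def coord_j)
  finally show ?thesis by simp
qed

lemma norm_diff_proj_le:
  assumes "finite A" "A \<subseteq> I"
  shows "norm (y - proj A y) \<le> norm y"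
proof (rule dense_induct[of "\<lambda>y. norm (y - proj A y) \<le> norm y"])
  show "closed {y. norm (y - proj A y) \<le> norm y}"
    by (intro closed_Collect_le continuous_intros continuous_proj)
  fix x assume x: "x \<in> c00 kk"
  have "norm (j x - proj A (j x)) = Xnorm kk (\<lambda>t. x t - cutoff A x t)"
    using x by (simp add: proj_j[OF assms] c00_cutoff norm_j[symmetric] c00_diff j_diff)
  also have "\<dots> \<le> Xnorm kk x"
    using x by (intro Xnorm_mono) (auto simp: cutoff_def)
  finally show "norm (j x - proj A (j x)) \<le> norm (j x)"
    by (simp add: norm_j x)
qed

text \<open>Once \<open>B\<close> contains the support of a finitely supported approximant,
  \<open>proj B\<close> fixes the approximant, and contractivity of the complementary projection
  bounds the remainder by the approximation error. That this holds for every such \<open>B\<close>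
  is unconditional convergence.\<close>

lemma has_sum_coord: "((\<lambda>t. coord t y *\<^sub>R e t) has_sum y) I"
  unfolding has_sum_def
proof (rule tendstoI)
  fix \<epsilon> :: real assume "0 < \<epsilon>"
  then obtain x where x: "x \<in> c00 kk" "norm (y - j x) < \<epsilon>"
    using approx by blast
  have "dist (proj B y) y < \<epsilon>" if B: "finite B" "{t. x t \<noteq> 0} \<subseteq> B" "B \<subseteq> I" for B
  proof -
    have "cutoff B x = x"
      using B by (auto simp: cutoff_def fun_eq_iff)
    then have "y - proj B y = (y - j x) - proj B (y - j x)"
      using B x by (simp add: proj_diff proj_j)
    then have "norm (y - proj B y) \<le> norm (y - j x)"
      using norm_diff_proj_le[OF B(1,3), of "y - j x"] by metis
    then show ?thesis
      using x(2) by (simp add: dist_norm norm_minus_commute)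
  qed
  moreover have "finite {t. x t \<noteq> 0} \<and> {t. x t \<noteq> 0} \<subseteq> I"
    using c00_finite[OF x(1)] c00_ksubsets[OF x(1)] by auto
  ultimately show "\<forall>\<^sub>F B in finite_subsets_at_top I. dist (\<Sum>t\<in>B. coord t y *\<^sub>R e t) y < \<epsilon>"
    unfolding eventually_finite_subsets_at_top proj_def by blast
qed

lemma coord_e: "t \<in> I \<Longrightarrow> s \<in> I \<Longrightarrow> coord t (e s) = (if t = s then 1 else 0)"
  using coord_j[OF _ c00_unitvec, of t s] by (auto simp: unitvec_def)

lemma has_sum_imp_coord:
  assumes "((\<lambda>t. a t *\<^sub>R e t) has_sum y) I" "t \<in> I"
  shows "a t = coord t y"
proof -
  have "((\<lambda>s. coord t (a s *\<^sub>R e s)) has_sum coord t y) I"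
    by (rule has_sum_bounded_linear[OF blinfun.bounded_linear_right assms(1)])
  moreover have "((\<lambda>s. coord t (a s *\<^sub>R e s)) has_sum a t) I"
    using assms(2) by (intro has_sum_finite_neutralI[of "{t}"]) (auto simp: blinfun.scaleR_right coord_e)
  ultimately show ?thesis
    using has_sum_unique by blast
qed

lemma unconditional_basis_e: "unconditional_basis I e"
  unfolding unconditional_basis_def
proof (intro conjI allI impI ballI)
  show "\<exists>a. ((\<lambda>t. a t *\<^sub>R e t) has_sum y) I" for y
    by (rule exI, rule has_sum_coord)
  fix y a a' t
  assume "((\<lambda>t. a t *\<^sub>R e t) has_sum y) I \<and> ((\<lambda>t. a' t *\<^sub>R e t) has_sum y) I" "t \<in> I"
  then show "a t = a' t"
    using has_sum_imp_coord[of a y t] has_sum_imp_coord[of a' y t] by simp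
qed

lemma coord_eq_0_imp: "(\<And>t. t \<in> I \<Longrightarrow> coord t y = 0) \<Longrightarrow> y = 0"
proof -
  assume "\<And>t. t \<in> I \<Longrightarrow> coord t y = 0"
  then have "((\<lambda>t. coord t y *\<^sub>R e t) has_sum 0) I"
    by (intro has_sum_0) auto
  then show "y = 0"
    using has_sum_coord has_sum_unique by blast
qed

lemma generates_sm_e: "generates_sm kk e NN (\<lambda>a m. \<Sum>i=1..m. \<bar>a i\<bar>)"
  unfolding generates_sm_def
\<comment> \<open>The two norms agree exactly; the sequence 1/(l + 1) only supplies the positive
  null sequence that the definition demands.\<close>
proof (intro conjI exI[of _ "\<lambda>l. 1 / real (Suc l)"] allI impI)
  show "infinite NN"
    by (simp add: NN_def infinite_Ici)
  then have inf: "infinite NN" .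
  show "(\<lambda>l. 1 / real (Suc l)) \<longlonglongrightarrow> 0"
    by (rule LIMSEQ_Suc[OF lim_1_over_n])
  fix l m :: nat and s :: "nat \<Rightarrow> nat set" and a :: "nat \<Rightarrow> real"
  assume *: "1 \<le> m \<and> m \<le> l \<and> plegma kk NN m s \<and> elM NN l \<le> el (s 1) 1 \<and> (\<forall>i\<in>{1..m}. \<bar>a i\<bar> \<le> 1)"
  then have pl: "plegma kk NN m s" and "1 \<le> m" by auto
  have "l \<le> elM NN l"
    using enumerate_ge_Suc[OF inf order_refl, of "l - 1"] * by (auto simp: elM_def)
  then have "m \<le> el (s 1) 1"
    using * by linarith
  then have P: "schreier_plegmatic kk (s ` {1..m})"
    by (intro plegma_schreier_plegmatic[OF pl order_refl kk \<open>1 \<le> m\<close>])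
  have sI: "s i \<in> I" if "i \<in> {1..m}" for i
    using pl that by (simp add: plegma_def)
  have inj: "inj_on s {1..m}"
    using plegma_inj_on[OF pl order_refl kk] by (intro inj_on_imageI2[of "\<lambda>t. el t 1"]) (simp add: comp_def)
  define x where "x = (\<lambda>t. \<Sum>i=1..m. a i * unitvec (s i) t)"
  have x: "x \<in> c00 kk"
    unfolding x_def by (intro c00_sum c00_cmult c00_unitvec sI)
  have xs: "x (s i) = a i" if "i \<in> {1..m}" for i
  proof -
    have "x (s i) = (\<Sum>i'=1..m. if i' = i then a i' else 0)"
      unfolding x_def
      by (intro sum.cong refl) (use inj_on_eq_iff[OF inj that] in \<open>simp add: unitvec_def\<close>)
    then show ?thesis
      using that by simp
  qed
  have "j x = (\<Sum>i=1..m. j (\<lambda>t. a i * unitvec (s i) t))"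
    unfolding x_def by (intro j_sum c00_cmult c00_unitvec sI)
  also have "\<dots> = (\<Sum>i=1..m. a i *\<^sub>R e (s i))"
    by (intro sum.cong refl j_cmult c00_unitvec sI)
  finally have jx: "j x = (\<Sum>i=1..m. a i *\<^sub>R e (s i))" .
  have "norm (j x) = (\<Sum>i=1..m. \<bar>a i\<bar>)"
  proof (rule antisym)
    show "norm (j x) \<le> (\<Sum>i=1..m. \<bar>a i\<bar>)"
      unfolding jx using sI by (intro order_trans[OF norm_sum] sum_mono) (simp add: norm_e)
    have "(\<Sum>i=1..m. \<bar>a i\<bar>) = (\<Sum>t\<in>s ` {1..m}. \<bar>x t\<bar>)"
      by (subst sum.reindex[OF inj]) (simp add: xs)
    also have "\<dots> \<le> norm (j x)"
      using Xnorm_ge_family[OF x P] by (simp add: norm_j x)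
    finally show "(\<Sum>i=1..m. \<bar>a i\<bar>) \<le> norm (j x)" .
  qed
  then show "\<bar>norm (\<Sum>i=1..m. a i *\<^sub>R e (s i)) - (\<Sum>i=1..m. \<bar>a i\<bar>)\<bar> \<le> 1 / real (Suc l)"
    by (simp add: jx)
qed auto

subsection \<open>Reflexivity\<close>

text \<open>The norm of a finitely supported vector is approximated by explicit finite combinations of
  coordinate functionals, which replaces the Hahn-Banach theorem.\<close>

lemma Xnorm_bidual_le:
  fixes \<phi> :: "('a \<Rightarrow>\<^sub>L real) \<Rightarrow>\<^sub>L real"
  assumes A: "finite A" "A \<subseteq> I"
  shows "Xnorm kk (cutoff A (\<lambda>t. \<phi> (coord t))) \<le> norm \<phi>"
proof (rule Xnorm_le)
  fix n :: nat and P assume P: "admissible kk {1..n} P"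
  define y where "y = cutoff A (\<lambda>t. \<phi> (coord t))"
  define p where "p = (\<lambda>i. \<Sum>s\<in>P i. \<bar>y s\<bar>)"
  define v where "v = L2_set p {1..n}"
  have PI: "s \<in> I" if "i \<in> {1..n}" "s \<in> P i" for i s
    using P that schreier_plegmatic_ksubsets unfolding admissible_def by blast
  \<comment> \<open>The norming functional of the collection \<open>P\<close> at \<open>y\<close>:
    weights \<open>p i\<close> for the l2 sum and signs inside each family. Cauchy-Schwarz gives
    norm at most \<open>v\<close>, while \<open>\<phi> f = v\<^sup>2\<close>; coordinates outside
    \<open>A\<close> drop out because sgn 0 = 0.\<close>
  define f where "f = (\<Sum>i=1..n. \<Sum>s\<in>P i. (p i * sgn (y s)) *\<^sub>R coord s)"
  have "norm f \<le> v"
  proof (rule norm_blinfun_bound)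
    show "0 \<le> v" by (simp add: v_def)
    show "norm (f z) \<le> v * norm z" for z
    proof (rule dense_induct[of "\<lambda>z. norm (f z) \<le> v * norm z"])
      show "closed {z. norm (f z) \<le> v * norm z}"
        by (intro closed_Collect_le continuous_intros)
      fix x assume x: "x \<in> c00 kk"
      have "f (j x) = (\<Sum>i=1..n. \<Sum>s\<in>P i. p i * sgn (y s) * x s)"
        unfolding f_def blinfun.sum_left blinfun.scaleR_left
        by (intro sum.cong refl) (simp add: coord_j PI x)
      also have "norm \<dots> \<le> (\<Sum>i=1..n. \<Sum>s\<in>P i. \<bar>p i\<bar> * \<bar>x s\<bar>)"
        unfolding real_norm_def
        by (intro order_trans[OF sum_abs] sum_mono order_trans[OF sum_abs])
          (simp add: abs_mult abs_sgn_eq mult_left_mono mult_nonneg_nonneg)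
      also have "\<dots> = (\<Sum>i=1..n. \<bar>p i\<bar> * \<bar>\<Sum>s\<in>P i. \<bar>x s\<bar>\<bar>)"
        by (simp add: sum_distrib_left[symmetric] sum_nonneg)
      also have "\<dots> \<le> v * L2_set (\<lambda>i. \<Sum>s\<in>P i. \<bar>x s\<bar>) {1..n}"
        unfolding v_def by (rule L2_set_mult_ineq)
      also have "\<dots> \<le> v * norm (j x)"
        unfolding norm_j[OF x] by (intro mult_left_mono Xnorm_ge[OF x P]) (simp add: v_def)
      finally show "norm (f (j x)) \<le> v * norm (j x)" .
    qed
  qed
  have "\<phi> f = (\<Sum>i=1..n. \<Sum>s\<in>P i. p i * \<bar>y s\<bar>)"
    unfolding f_def blinfun.sum_right blinfun.scaleR_right
  proof (intro sum.cong refl)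
    fix i s
    show "(p i * sgn (y s)) *\<^sub>R \<phi> (coord s) = p i * \<bar>y s\<bar>"
      by (cases "s \<in> A") (auto simp: y_def cutoff_def abs_sgn mult.commute)
  qed
  also have "\<dots> = v\<^sup>2"
    by (simp add: v_def L2_set_def sum_nonneg sum_distrib_left[symmetric] power2_eq_square p_def)
  finally have "v * v \<le> norm \<phi> * norm f"
    using norm_blinfun[of \<phi> f] by (simp add: power2_eq_square)
  also have "\<dots> \<le> norm \<phi> * v"
    using \<open>norm f \<le> v\<close> by (intro mult_left_mono) auto
  finally have "v * v \<le> norm \<phi> * v" .
  moreover have "0 \<le> v"
    by (simp add: v_def)
  ultimately have "v \<le> norm \<phi>"
    by (cases "v = 0") (auto simp: mult_le_cancel_right)
  then show "L2_set (\<lambda>i. \<Sum>s\<in>P i. \<bar>cutoff A (\<lambda>t. \<phi> (coord t)) s\<bar>) {1..n} \<le> norm \<phi>"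
    by (simp add: v_def p_def y_def)
qed

text \<open>If \<open>A n\<close> nearly attains the supremum of the squared norms, the lower
  2-estimate leaves norm at most 1/(n + 1) for every finite set disjoint from it. Hence the partial
  vectors over the \<open>A n\<close> form a Cauchy sequence, whose limit has the required
  coordinates.\<close>

lemma boundedly_complete:
  assumes K: "\<And>A. finite A \<Longrightarrow> A \<subseteq> I \<Longrightarrow> Xnorm kk (cutoff A c) \<le> K"
  obtains y where "\<And>t. t \<in> I \<Longrightarrow> coord t y = c t"
proof -
  define \<A> where "\<A> = {A. finite A \<and> A \<subseteq> I}"
  define V where "V = (\<lambda>A. (Xnorm kk (cutoff A c))\<^sup>2)"
  have c00: "cutoff A c \<in> c00 kk" if "A \<in> \<A>" for A
    using that by (intro j_expand(2)[of A]) (auto simp: \<A>_def cutoff_def)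
  define S where "S = Sup (V ` \<A>)"
  have bdd: "bdd_above (V ` \<A>)"
    by (rule bdd_aboveI2[of _ _ "K\<^sup>2"])
      (use K c00 in \<open>auto simp: V_def \<A>_def intro!: power_mono Xnorm_nonneg\<close>)
  have "{} \<in> \<A>" by (simp add: \<A>_def)
  have "\<exists>A\<in>\<A>. S - (1 / real (Suc n))\<^sup>2 < V A" for n
  proof -
    have "S - (1 / real (Suc n))\<^sup>2 < Sup (V ` \<A>)"
      by (simp add: S_def)
    then show ?thesis
      using less_cSup_iff[OF _ bdd] \<open>{} \<in> \<A>\<close> by auto
  qed
  then obtain A where A: "\<And>n. A n \<in> \<A>" "\<And>n. S - (1 / real (Suc n))\<^sup>2 < V (A n)"
    by metis
  have small: "Xnorm kk (cutoff B c) \<le> 1 / real (Suc n)" if "B \<in> \<A>" "B \<inter> A n = {}" for B n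
  proof -
    have "V (A n) + V B \<le> (Xnorm kk (\<lambda>t. cutoff (A n) c t + cutoff B c t))\<^sup>2"
      unfolding V_def using that
      by (intro Xnorm_lower_2_estimate c00 A) (auto simp: cutoff_def)
    also have "(\<lambda>t. cutoff (A n) c t + cutoff B c t) = cutoff (A n \<union> B) c"
      using that by (auto simp: cutoff_def fun_eq_iff)
    also have "(Xnorm kk (cutoff (A n \<union> B) c))\<^sup>2 \<le> S"
    proof -
      have "A n \<union> B \<in> \<A>"
        using A(1)[of n] that(1) by (auto simp: \<A>_def)
      then show ?thesis
        using cSup_upper[OF imageI bdd] by (simp add: S_def V_def)
    qed
    finally have "(Xnorm kk (cutoff B c))\<^sup>2 \<le> (1 / real (Suc n))\<^sup>2"
      using A(2)[of n] by (simp add: V_def)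
    then show ?thesis
      by (rule power2_le_imp_le) simp
  qed
  define Y where "Y = (\<lambda>n. j (cutoff (A n) c))"
  have diff: "norm (Y m - Y n) \<le> 1 / real (Suc m) + 1 / real (Suc n)" for m n
  proof -
    have \<A>_diff: "A m - A n \<in> \<A>" for m n
      using A(1)[of m] by (auto simp: \<A>_def)
    have "Y m - Y n = j (\<lambda>t. cutoff (A m) c t - cutoff (A n) c t)"
      by (simp add: Y_def j_diff c00 A)
    \<comment> \<open>The sets \<open>A n\<close> need not be nested. Their common part cancels, and
      each of the two differences left is disjoint from one of the sets, so \<open>small\<close>
      applies to it.\<close>
    also have "(\<lambda>t. cutoff (A m) c t - cutoff (A n) c t)
        = (\<lambda>t. cutoff (A m - A n) c t - cutoff (A n - A m) c t)"
      by (auto simp: cutoff_def)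
    also have "j \<dots> = j (cutoff (A m - A n) c) - j (cutoff (A n - A m) c)"
      by (intro j_diff c00 \<A>_diff)
    also have "norm \<dots> \<le> norm (j (cutoff (A m - A n) c)) + norm (j (cutoff (A n - A m) c))"
      by (rule norm_triangle_ineq4)
    also have "\<dots> \<le> 1 / real (Suc n) + 1 / real (Suc m)"
      unfolding norm_j[OF c00[OF \<A>_diff]] by (intro add_mono small \<A>_diff) auto
    finally show ?thesis by simp
  qed
  have "Cauchy Y"
  proof (rule CauchyI)
    fix \<epsilon> :: real assume "0 < \<epsilon>"
    then obtain N where N: "1 / real (Suc N) < \<epsilon> / 2"
      using nat_approx_posE[of "\<epsilon> / 2"] by (auto simp: field_simps)
    have "1 / real (Suc m) \<le> 1 / real (Suc N)" if "N \<le> m" for m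
      using that by (intro divide_left_mono) auto
    then have "norm (Y m - Y n) < \<epsilon>" if "N \<le> m" "N \<le> n" for m n
      using diff[of m n] N that by (smt (verit) field_sum_of_halves)
    then show "\<exists>N. \<forall>m\<ge>N. \<forall>n\<ge>N. norm (Y m - Y n) < \<epsilon>"
      by blast
  qed
  then obtain y where y: "Y \<longlonglongrightarrow> y"
    using Cauchy_convergent_iff convergent_def by blast
  have "coord t y = c t" if t: "t \<in> I" for t
  proof -
    have "(\<lambda>n. coord t (Y n)) \<longlonglongrightarrow> coord t y"
      by (intro tendsto_intros y)
    moreover have "(\<lambda>n. coord t (Y n)) \<longlonglongrightarrow> c t"
    proof (rule LIMSEQ_I)
      fix \<epsilon> :: real assume "0 < \<epsilon>"
      then obtain N where N: "1 / real (Suc N) < \<epsilon>"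
        using nat_approx_posE[of \<epsilon>] by (auto simp: field_simps)
      have Yn: "coord t (Y n) = cutoff (A n) c t" for n
        by (simp add: Y_def coord_j t c00 A(1))
      have "\<bar>coord t (Y n) - c t\<bar> \<le> 1 / real (Suc n)" for n
      proof (cases "t \<in> A n")
        case False
        \<comment> \<open>A coordinate missed by \<open>A n\<close> is itself a set disjoint from
          \<open>A n\<close>.\<close>
        have "{t} \<in> \<A>" using t by (simp add: \<A>_def)
        then have "\<bar>cutoff {t} c t\<bar> \<le> 1 / real (Suc n)"
          using Xnorm_ge_coord[OF c00 t kk, of "{t}"] small[of "{t}" n] False by simp
        then show ?thesis
          using False by (simp add: Yn cutoff_def)
      qed (simp add: Yn cutoff_def)
      moreover have "1 / real (Suc n) \<le> 1 / real (Suc N)" if "N \<le> n" for n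
        using that by (intro divide_left_mono) auto
      ultimately have "norm (coord t (Y n) - c t) < \<epsilon>" if "N \<le> n" for n
        using N that by (smt (verit) real_norm_def)
      then show "\<exists>no. \<forall>n\<ge>no. norm (coord t (Y n) - c t) < \<epsilon>"
        by blast
    qed
    ultimately show ?thesis
      using LIMSEQ_unique by blast
  qed
  then show ?thesis
    by (rule that)
qed

text \<open>Otherwise one finds a disjointly supported bounded sequence on which the functional is bounded
  away from zero; by unconditionality signs are irrelevant, so its alternating sums along plegma
  families, which for 1-subsets are just finite subsequences, cannot be small.\<close>

lemma shrinking:
  fixes f :: "'a \<Rightarrow>\<^sub>L real"
  assumes "2 \<le> kk" "0 < \<epsilon>"
  shows "\<exists>A. finite A \<and> A \<subseteq> I \<and> (\<forall>x\<in>c00 kk. (\<forall>t\<in>A. x t = 0) \<longrightarrow> \<bar>f (j x)\<bar> \<le> \<epsilon> * Xnorm kk x)"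
proof (rule ccontr)
  assume neg: "\<not> ?thesis"
  have "\<exists>z. finite A \<and> A \<subseteq> I \<longrightarrow>
      z \<in> c00 kk \<and> Xnorm kk z \<le> 1 \<and> (\<forall>t\<in>A. z t = 0) \<and> \<epsilon> \<le> f (j z)" for A
  proof (cases "finite A \<and> A \<subseteq> I")
    case True
    then have "\<not> (\<forall>x\<in>c00 kk. (\<forall>t\<in>A. x t = 0) \<longrightarrow> \<bar>f (j x)\<bar> \<le> \<epsilon> * Xnorm kk x)"
      using neg by blast
    then obtain x where x: "x \<in> c00 kk" "\<forall>t\<in>A. x t = 0" "\<epsilon> * Xnorm kk x < \<bar>f (j x)\<bar>"
      by (auto simp: not_le)
    have pos: "0 < Xnorm kk x"
    proof (rule ccontr)
      assume "\<not> 0 < Xnorm kk x"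
      then have "j x = 0"
        using norm_j[OF x(1)] by (metis norm_le_zero_iff not_le)
      then show False
        using x norm_j[OF x(1)] by simp
    qed
    \<comment> \<open>Normalisation combined with the sign that makes the value of \<open>f\<close>
      positive, so that these values add up later.\<close>
    define r where "r = sgn (f (j x)) / Xnorm kk x"
    define z where "z = (\<lambda>t. r * x t)"
    have z: "z \<in> c00 kk"
      unfolding z_def by (rule c00_cmult[OF x(1)])
    have jz: "j z = r *\<^sub>R j x"
      unfolding z_def by (rule j_cmult[OF x(1)])
    have "Xnorm kk z = \<bar>r\<bar> * Xnorm kk x"
      using norm_j[OF z] norm_j[OF x(1)] by (simp add: jz)
    also have "\<dots> \<le> 1"
      using pos by (simp add: r_def abs_divide abs_sgn_eq)
    finally have "Xnorm kk z \<le> 1" .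
    moreover have "f (j z) = \<bar>f (j x)\<bar> / Xnorm kk x"
      by (simp add: jz r_def blinfun.scaleR_right abs_sgn mult.commute)
    then have "\<epsilon> \<le> f (j z)"
      using x(3) pos by (simp add: pos_le_divide_eq less_imp_le)
    ultimately show ?thesis
      using z x(2) by (intro exI[of _ z]) (auto simp: z_def)
  qed blast
  then obtain Z where Z: "\<And>A. finite A \<Longrightarrow> A \<subseteq> I \<Longrightarrow>
      Z A \<in> c00 kk \<and> Xnorm kk (Z A) \<le> 1 \<and> (\<forall>t\<in>A. Z A t = 0) \<and> \<epsilon> \<le> f (j (Z A))"
    by metis
  \<comment> \<open>A gliding hump: \<open>A n\<close> accumulates the supports of all earlier
    vectors, and the next vector vanishes there.\<close>
  define A where "A = rec_nat {} (\<lambda>_ A. A \<union> {t. Z A t \<noteq> 0})"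
  have A_Suc: "A (Suc n) = A n \<union> {t. Z (A n) t \<noteq> 0}" for n
    by (simp add: A_def)
  have A: "finite (A n) \<and> A n \<subseteq> I" for n
  proof (induction n)
    case (Suc n)
    then have "Z (A n) \<in> c00 kk"
      using Z by blast
    then have "finite {t. Z (A n) t \<noteq> 0}" "{t. Z (A n) t \<noteq> 0} \<subseteq> I"
      using c00_finite c00_ksubsets by blast+
    then show ?case
      using Suc by (simp add: A_Suc)
  qed (simp add: A_def)
  define W where "W = (\<lambda>n. Z (A n))"
  have W: "W n \<in> c00 kk" "Xnorm kk (W n) \<le> 1" "\<And>t. t \<in> A n \<Longrightarrow> W n t = 0" "\<epsilon> \<le> f (j (W n))" for n
    using Z[of "A n"] A[of n] by (auto simp: W_def)
  have A_mono: "A m \<subseteq> A n" if "m \<le> n" for m n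
    using that by (rule lift_Suc_mono_le[of A, rotated]) (auto simp: A_Suc)
  have disj: "W m t = 0 \<or> W n t = 0" if "m \<noteq> n" for m n t
  proof -
    have *: "W m t = 0 \<or> W n t = 0" if "m < n" for m n
    proof (cases "W m t = 0")
      case False
      then have "t \<in> A (Suc m)"
        by (simp add: A_Suc W_def)
      then show ?thesis
        using A_mono[of "Suc m" n] that W(3)[of t n] by auto
    qed simp
    show ?thesis
      using that *[of m n] *[of n m] by (cases "m < n") auto
  qed
  \<comment> \<open>The added 1 covers the case of norm 0 and makes the final inequality
    strict.\<close>
  define c where "c = \<epsilon> / (norm f + 1)"
  have "0 < c"
    using \<open>0 < \<epsilon>\<close> by (simp add: c_def add_nonneg_pos)
  have "\<exists>m\<ge>1. \<forall>L. \<exists>s. plegma 1 UNIV m s \<and> L \<le> el (s 1) 1 \<and>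
      Xnorm kk (\<lambda>t. \<Sum>i=1..m. (-1) ^ i * W (el (s i) 1) t) \<le> c * real m"
    using W \<open>0 < c\<close> \<open>2 \<le> kk\<close>
    by (intro alternating_plegma_sum_small[where w = "\<lambda>s. W (el s 1)" and C = 1]) auto
  then obtain m s where m: "1 \<le> m" and pl: "plegma 1 UNIV m s"
    and small: "Xnorm kk (\<lambda>t. \<Sum>i=1..m. (-1) ^ i * W (el (s i) 1) t) \<le> c * real m"
    by blast
  define x where "x = (\<lambda>t. \<Sum>i=1..m. W (el (s i) 1) t)"
  have x: "x \<in> c00 kk"
    unfolding x_def by (intro c00_sum W)
  have "Xnorm kk x = Xnorm kk (\<lambda>t. \<Sum>i=1..m. (-1) ^ i * W (el (s i) 1) t)"
  proof (rule Xnorm_abs_cong[OF x])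
    fix t
    show "\<bar>x t\<bar> = \<bar>\<Sum>i=1..m. (-1) ^ i * W (el (s i) 1) t\<bar>"
      unfolding x_def
    proof (rule alternating_sum_disjoint[symmetric])
      fix a b assume "a \<in> {1..m}" "b \<in> {1..m}" "a \<noteq> b"
      then have "el (s a) 1 \<noteq> el (s b) 1"
        using inj_on_eq_iff[OF plegma_inj_on[OF pl order_refl order_refl]] by simp
      then show "W (el (s a) 1) t = 0 \<or> W (el (s b) 1) t = 0"
        by (rule disj)
    qed
  qed
  with small have "norm (j x) \<le> c * real m"
    by (simp add: norm_j x)
  have "\<epsilon> * real m = (\<Sum>i=1..m. \<epsilon>)"
    by simp
  also have "\<dots> \<le> (\<Sum>i=1..m. f (j (W (el (s i) 1))))"
    by (intro sum_mono W)
  also have "\<dots> = f (j x)"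
    unfolding x_def by (simp add: j_sum W blinfun.sum_right)
  also have "\<dots> \<le> norm f * norm (j x)"
    using norm_blinfun[of f "j x"] by simp
  also have "\<dots> \<le> norm f * (c * real m)"
    using \<open>norm (j x) \<le> c * real m\<close> by (intro mult_left_mono) auto
  also have "\<dots> < (norm f + 1) * (c * real m)"
    using m \<open>0 < c\<close> by simp
  also have "\<dots> = \<epsilon> * real m"
    using norm_ge_zero[of f] by (simp add: c_def add_nonneg_eq_0_iff)
  finally show False by simp
qed

text \<open>Bounded completeness yields a vector \<open>y\<close> with the coordinates prescribed by
  \<open>\<phi>\<close>. Shrinking makes combinations of coordinate functionals dense in the dual,
  and on these \<open>\<phi>\<close> agrees with evaluation at \<open>y\<close>.\<close>

lemma reflexive_completion:
  assumes "2 \<le> kk"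
  shows "reflexive TYPE('a)"
  unfolding reflexive_def
proof
  fix \<phi> :: "('a \<Rightarrow>\<^sub>L real) \<Rightarrow>\<^sub>L real"
  obtain y where y: "\<And>t. t \<in> I \<Longrightarrow> coord t y = \<phi> (coord t)"
    using boundedly_complete[of "\<lambda>t. \<phi> (coord t)" "norm \<phi>"] Xnorm_bidual_le by blast
  have "\<phi> f = f y" for f
  proof -
    have "\<bar>\<phi> f - f y\<bar> \<le> \<epsilon> * (norm \<phi> + norm y)" if \<epsilon>: "0 < \<epsilon>" for \<epsilon>
    proof -
      obtain A where A: "finite A" "A \<subseteq> I"
        and f: "\<forall>x\<in>c00 kk. (\<forall>t\<in>A. x t = 0) \<longrightarrow> \<bar>f (j x)\<bar> \<le> \<epsilon> * Xnorm kk x"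
        using shrinking[OF assms \<epsilon>, of f] by blast
      \<comment> \<open>\<open>g\<close> is \<open>f\<close> composed with \<open>proj A\<close>.
        The difference \<open>f - g\<close> is \<open>f\<close> on the part of a vector outside
        \<open>A\<close>, where the choice of \<open>A\<close> makes it small.\<close>
      define g where "g = (\<Sum>t\<in>A. f (e t) *\<^sub>R coord t)"
      have g: "g z = f (proj A z)" for z
        by (simp add: g_def proj_def blinfun.sum_left blinfun.sum_right blinfun.scaleR_left
            blinfun.scaleR_right mult.commute)
      have "norm (f - g) \<le> \<epsilon>"
      proof (rule norm_blinfun_bound)
        show "norm ((f - g) z) \<le> \<epsilon> * norm z" for z
        proof (rule dense_induct[of "\<lambda>z. norm ((f - g) z) \<le> \<epsilon> * norm z"])
          show "closed {z. norm ((f - g) z) \<le> \<epsilon> * norm z}"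
            by (intro closed_Collect_le continuous_intros)
          fix x assume x: "x \<in> c00 kk"
          let ?x = "\<lambda>t. x t - cutoff A x t"
          have "(f - g) (j x) = f (j ?x)"
            by (simp add: blinfun.diff_left g proj_j[OF A x] j_diff x c00_cutoff blinfun.diff_right)
          moreover have "\<bar>f (j ?x)\<bar> \<le> \<epsilon> * Xnorm kk ?x"
            using f c00_diff[OF x c00_cutoff[OF x]] by (auto simp: cutoff_def)
          moreover have "Xnorm kk ?x \<le> Xnorm kk x"
            using x by (intro Xnorm_mono) (auto simp: cutoff_def)
          then have "\<epsilon> * Xnorm kk ?x \<le> \<epsilon> * Xnorm kk x"
            using \<epsilon> by simp
          ultimately show "norm ((f - g) (j x)) \<le> \<epsilon> * norm (j x)"
            by (simp add: norm_j x)
        qed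
      qed (use \<epsilon> in simp)
      have "\<phi> g = (\<Sum>t\<in>A. f (e t) * coord t y)"
        unfolding g_def blinfun.sum_right blinfun.scaleR_right
        using A(2) y by (intro sum.cong) auto
      also have "\<dots> = g y"
        by (simp add: g_def blinfun.sum_left blinfun.scaleR_left)
      finally have "\<phi> f - f y = \<phi> (f - g) - (f - g) y"
        by (simp add: blinfun.diff_right blinfun.diff_left)
      moreover have "\<bar>\<phi> (f - g)\<bar> \<le> norm \<phi> * \<epsilon>"
        using norm_blinfun[of \<phi> "f - g"] mult_left_mono[OF \<open>norm (f - g) \<le> \<epsilon>\<close>, of "norm \<phi>"] by simp
      moreover have "\<bar>(f - g) y\<bar> \<le> \<epsilon> * norm y"
        using norm_blinfun[of "f - g" y] mult_right_mono[OF \<open>norm (f - g) \<le> \<epsilon>\<close>, of "norm y"] by simp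
      ultimately show ?thesis
        by (simp add: algebra_simps)
    qed
    note bound = this
    show ?thesis
    proof (rule ccontr)
      assume "\<phi> f \<noteq> f y"
      define K where "K = norm \<phi> + norm y + 1"
      have K: "0 < K" "norm \<phi> + norm y < K"
        by (auto simp: K_def add_nonneg_pos)
      define \<epsilon> where "\<epsilon> = \<bar>\<phi> f - f y\<bar> / K"
      have "0 < \<epsilon>"
        using \<open>\<phi> f \<noteq> f y\<close> K by (simp add: \<epsilon>_def)
      then have "\<epsilon> * (norm \<phi> + norm y) < \<epsilon> * K"
        using K by simp
      also have "\<dots> = \<bar>\<phi> f - f y\<bar>"
        using K by (simp add: \<epsilon>_def)
      finally show False
        using bound[OF \<open>0 < \<epsilon>\<close>] by simp
    qed
  qed
  then show "\<exists>x. \<forall>f. \<phi> f = f x"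
    by blast
qed

subsection \<open>Spreading models of lower order\<close>

text \<open>With alternating signs an l1 basis has norm at least c * m, whereas the sequence admits
  at most c/2 * m: half of this from approximation by finitely supported vectors, half from the
  alternating estimate. An error below c/2 cannot bridge the difference.\<close>

lemma no_l1_spreading_model:
  fixes x :: "nat set \<Rightarrow> 'a" and nrm :: "'e::real_vector \<Rightarrow> real"
  assumes k: "1 \<le> k" "k < kk" and sm: "k_spreading_model k x M nrm b"
  shows "\<not> equiv_l1_basis nrm b"
proof
  assume "equiv_l1_basis nrm b"
  then obtain c C where c: "0 < c"
    and lower: "\<And>m a. c * (\<Sum>i=1..m. \<bar>a i\<bar>) \<le> nrm (\<Sum>i=1..m. a i *\<^sub>R b i)"
    and upper: "\<And>m a. nrm (\<Sum>i=1..m. a i *\<^sub>R b i) \<le> C * (\<Sum>i=1..m. \<bar>a i\<bar>)"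
    unfolding equiv_l1_basis_def by blast
  obtain \<delta> where M: "M \<subseteq> NN" "infinite M" and \<delta>: "\<delta> \<longlonglongrightarrow> 0"
    and gen: "\<And>l m s a. 1 \<le> m \<Longrightarrow> m \<le> l \<Longrightarrow> plegma k M m s \<Longrightarrow> elM M l \<le> el (s 1) 1 \<Longrightarrow>
      (\<And>i. i \<in> {1..m} \<Longrightarrow> \<bar>a i\<bar> \<le> 1) \<Longrightarrow>
      \<bar>norm (\<Sum>i=1..m. a i *\<^sub>R x (s i)) - nrm (\<Sum>i=1..m. a i *\<^sub>R b i)\<bar> \<le> \<delta> l"
    using sm unfolding k_spreading_model_def generates_sm_def by auto
  \<comment> \<open>The case m = l = 1 of the spreading model condition bounds the whole sequence on
    \<open>M\<close>, since every nonempty subset of \<open>M\<close> starts at or after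
    M(1).\<close>
  have x_bound: "norm (x s) \<le> C + \<delta> 1" if s: "s \<in> ksubsets M k" for s
  proof -
    have s': "finite s" "card s = k" "s \<subseteq> M"
      using s by (auto simp: ksubsets_def)
    have "plegma k M 1 (\<lambda>_. s)"
      using s el_less[OF s'(1)] s'(2) by (auto simp: plegma_def)
    moreover have "elM M 1 \<le> el s 1"
      using el_mem[OF s'(1), of 1] s' k by (auto simp: elM_def enumerate_0 intro!: Least_le)
    ultimately have "\<bar>norm (x s) - nrm (b 1)\<bar> \<le> \<delta> 1"
      using gen[of 1 1 "\<lambda>_. s" "\<lambda>_. 1"] by simp
    moreover have "nrm (b 1) \<le> C"
      using upper[of "\<lambda>_. 1" 1] by simp
    ultimately show ?thesis
      by linarith
  qed
  have "\<exists>y. y \<in> c00 kk \<and> norm (x s - j y) < c / 4" for s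
    using approx[of "c / 4" "x s"] c by auto
  then obtain w where w: "\<And>s. w s \<in> c00 kk" "\<And>s. norm (x s - j (w s)) < c / 4"
    by metis
  have w_bound: "Xnorm kk (w s) \<le> C + \<delta> 1 + c / 4" if "s \<in> ksubsets M k" for s
  proof -
    have "norm (j (w s)) \<le> norm (x s) + norm (x s - j (w s))"
      by (metis norm_minus_commute norm_triangle_sub)
    then show ?thesis
      using x_bound[OF that] w(2)[of s] by (simp add: norm_j w)
  qed
  have "\<exists>m\<ge>1. \<forall>L. \<exists>s. plegma k M m s \<and> L \<le> el (s 1) 1 \<and>
      Xnorm kk (\<lambda>t. \<Sum>i=1..m. (-1) ^ i * w (s i) t) \<le> c / 4 * real m"
    using c by (intro alternating_plegma_sum_small[OF k M(2) w(1) w_bound]) auto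
  then obtain m where m: "1 \<le> m" and small: "\<And>L. \<exists>s. plegma k M m s \<and> L \<le> el (s 1) 1 \<and>
      Xnorm kk (\<lambda>t. \<Sum>i=1..m. (-1) ^ i * w (s i) t) \<le> c / 4 * real m"
    by blast
  \<comment> \<open>\<open>l\<close> is chosen after \<open>m\<close>; then \<open>elM M l\<close>
    serves as the starting bound of the plegma family.\<close>
  obtain l where l: "m \<le> l" "\<delta> l < c / 2"
  proof -
    have "\<forall>\<^sub>F l in sequentially. \<delta> l < c / 2"
      using order_tendstoD(2)[OF \<delta>, of "c / 2"] c by simp
    then have "\<forall>\<^sub>F l in sequentially. \<delta> l < c / 2 \<and> m \<le> l"
      by (intro eventually_conj eventually_ge_at_top)
    then show ?thesis
      using that eventually_happens'[OF sequentially_bot] by blast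
  qed
  obtain s where pl: "plegma k M m s" and s1: "elM M l \<le> el (s 1) 1"
    and s: "Xnorm kk (\<lambda>t. \<Sum>i=1..m. (-1) ^ i * w (s i) t) \<le> c / 4 * real m"
    using small by blast
  have "norm (\<Sum>i=1..m. (-1) ^ i *\<^sub>R x (s i))
      = norm (j (\<lambda>t. \<Sum>i=1..m. (-1) ^ i * w (s i) t) + (\<Sum>i=1..m. (-1) ^ i *\<^sub>R (x (s i) - j (w (s i)))))"
    by (simp add: j_sum c00_cmult w j_cmult scaleR_diff_right sum_subtractf)
  also have "\<dots> \<le> c / 4 * real m + (\<Sum>i=1..m. norm ((-1) ^ i *\<^sub>R (x (s i) - j (w (s i)))))"
  proof (intro order_trans[OF norm_triangle_ineq] add_mono norm_sum)
    show "norm (j (\<lambda>t. \<Sum>i=1..m. (-1) ^ i * w (s i) t)) \<le> c / 4 * real m"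
      by (subst norm_j) (use s in \<open>auto intro!: c00_sum c00_cmult w\<close>)
  qed
  also have "\<dots> \<le> c / 4 * real m + (\<Sum>i=1..m. c / 4)"
    using w(2) by (intro add_mono sum_mono order_refl) (simp add: power_abs less_imp_le)
  also have "\<dots> = c / 2 * real m"
    by simp
  finally have "norm (\<Sum>i=1..m. (-1) ^ i *\<^sub>R x (s i)) \<le> c / 2 * real m" .
  moreover have "\<bar>norm (\<Sum>i=1..m. (-1) ^ i *\<^sub>R x (s i)) - nrm (\<Sum>i=1..m. (-1) ^ i *\<^sub>R b i)\<bar> \<le> \<delta> l"
    using gen[OF m l(1) pl s1, of "\<lambda>i. (-1) ^ i"] by (simp add: power_abs)
  moreover have "c * real m \<le> nrm (\<Sum>i=1..m. (-1) ^ i *\<^sub>R b i)"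
    using lower[of "\<lambda>i. (-1) ^ i" m] by (simp add: power_abs)
  moreover have "c / 2 * 1 \<le> c / 2 * real m"
    using m c by (intro mult_left_mono) auto
  moreover have "c / 2 * real m + c / 2 * real m = c * real m"
    by simp
  ultimately show False
    using l(2) by linarith
qed

subsection \<open>Cesaro means\<close>

text \<open>Coordinates of the means tend to 0, so 0 is the only candidate limit. But one Schreier
  plegmatic family contains a fixed proportion of the sets averaged over, which keeps the norms
  along a subsequence above a positive constant.\<close>

lemma not_cesaro_summable:
  assumes M: "M \<subseteq> NN" "infinite M"
  shows "\<not> cesaro_summable kk e M x0"
proof
  assume "cesaro_summable kk e M x0"
  \<comment> \<open>Only lengths (kk + 1) * N are considered: the first N elements of
    \<open>M\<close> are skipped for the sake of the Schreier condition, and kk blocks of length N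
    follow.\<close>
  define avg where "avg = (\<lambda>N. (1 / real ((kk + 1) * N choose kk)) *\<^sub>R
    (\<Sum>s\<in>ksubsets (restr M ((kk + 1) * N)) kk. e s))"
  have "strict_mono (\<lambda>N. (kk + 1) * N)"
    by (rule strict_monoI, rule mult_less_mono2) auto
  then have avg: "avg \<longlonglongrightarrow> x0"
    using LIMSEQ_subseq_LIMSEQ[OF \<open>cesaro_summable kk e M x0\<close>[unfolded cesaro_summable_def]]
    by (simp add: avg_def comp_def)
  have elM_ge: "l \<le> elM M l" if "1 \<le> l" for l
    using enumerate_ge_Suc[OF M(2,1), of "l - 1"] that by (simp add: elM_def)
  have elM_less: "elM M l < elM M l'" if "1 \<le> l" "l < l'" for l l'
    using that M(2) by (auto simp: elM_def intro!: enumerate_mono)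
  have elM_M: "elM M l \<in> M" for l
    using enumerate_in_set[OF M(2)] by (simp add: elM_def)
  define Q where "Q = (\<lambda>N. ksubsets (restr M ((kk + 1) * N)) kk)"
  define v where "v = (\<lambda>N t. if t \<in> Q N then 1 / real ((kk + 1) * N choose kk) else 0)"
  have Q: "finite (Q N)" "Q N \<subseteq> I" for N
  proof -
    have "restr M ((kk + 1) * N) \<subseteq> NN"
      using elM_M M(1) by (auto simp: restr_def)
    then show "Q N \<subseteq> I"
      unfolding Q_def by (rule ksubsets_mono)
    show "finite (Q N)"
      by (rule finite_subset[of _ "Pow (restr M ((kk + 1) * N))"]) (auto simp: Q_def ksubsets_def restr_def)
  qed
  have v: "v N \<in> c00 kk" "j (v N) = avg N" for N
  proof -
    have out: "v N t = 0" if "t \<notin> Q N" for t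
      using that by (simp add: v_def)
    show "v N \<in> c00 kk"
      using j_expand(2)[OF Q out] .
    have "j (v N) = (\<Sum>t\<in>Q N. v N t *\<^sub>R e t)"
      using j_expand(1)[OF Q out] .
    also have "\<dots> = avg N"
      by (simp add: v_def avg_def Q_def scaleR_sum_right)
    finally show "j (v N) = avg N" .
  qed
  have le: "kk \<le> (kk + 1) * N" if "1 \<le> N" for N
    using mult_le_mono[OF le_add1[of kk 1] that] by simp
  \<comment> \<open>A crude growth rate is enough: it only serves to make each single coordinate of
    the means vanish in the limit.\<close>
  have choose_ge: "real N \<le> real ((kk + 1) * N choose kk)" if "1 \<le> N" for N
  proof -
    have "real N \<le> real N ^ kk"
      using that kk by (intro self_le_power) auto
    also have "\<dots> \<le> (real ((kk + 1) * N) / real kk) ^ kk"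
      using kk by (intro power_mono) (auto simp: field_simps)
    also have "\<dots> \<le> real ((kk + 1) * N choose kk)"
      by (rule binomial_ge_n_over_k_pow_k[OF le[OF that]])
    finally show ?thesis .
  qed
  have "coord t x0 = 0" if t: "t \<in> I" for t
  proof -
    have "(\<lambda>N. coord t (avg N)) \<longlonglongrightarrow> coord t x0"
      by (intro tendsto_intros avg)
    moreover have "(\<lambda>N. coord t (avg N)) \<longlonglongrightarrow> 0"
    proof (rule Lim_null_comparison[OF _ lim_1_over_n])
      have "norm (coord t (avg N)) \<le> 1 / real N" if "1 \<le> N" for N
      proof -
        have "norm (coord t (avg N)) \<le> 1 / real ((kk + 1) * N choose kk)"
          unfolding v(2)[symmetric] coord_j[OF t v(1)] by (simp add: v_def)
        also have "\<dots> \<le> 1 / real N"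
          using choose_ge[OF that] that by (intro frac_le) simp_all
        finally show ?thesis .
      qed
      then show "\<forall>\<^sub>F N in sequentially. norm (coord t (avg N)) \<le> 1 / real N"
        using eventually_ge_at_top[of 1] by (rule eventually_mono[rotated])
    qed
    ultimately show ?thesis
      using LIMSEQ_unique by blast
  qed
  then have "x0 = 0"
    by (rule coord_eq_0_imp)
  have "1 / real (kk + 1) ^ kk \<le> norm (avg N)" if N: "1 \<le> N" for N
  proof -
    \<comment> \<open>Block \<open>i\<close> starts after i * N elements of \<open>M\<close>, so
      already the entries of the first block exceed the block size N.\<close>
    define F where "F = (\<lambda>i. elM M ` {i * N + 1..(i + 1) * N})"
    define P where "P = {t \<in> I. \<forall>i\<in>{1..kk}. el t i \<in> F i}"
    have inj: "inj_on (elM M) {1..}"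
      by (rule linorder_inj_onI) (use elM_less in force)+
    have card_F: "card (F i) = N" for i
      unfolding F_def by (subst card_image) (auto intro: inj_on_subset[OF inj])
    have F_less: "a < b" if "a \<in> F i" "b \<in> F i'" "i < i'" for a b i i'
    proof -
      have "(i + 1) * N \<le> i' * N"
        using that(3) by (intro mult_right_mono) auto
      then show ?thesis
        using that(1,2) by (auto simp: F_def intro!: elM_less)
    qed
    have P: "schreier_plegmatic kk P"
      unfolding schreier_plegmatic_def
    proof (intro exI[of _ F] conjI)
      show "plegmatic_witness kk P F"
        unfolding plegmatic_witness_def
      proof (intro conjI ballI)
        show "finite (F i)" "F i \<noteq> {}" for i
          using N by (auto simp: F_def)
        show "card (F i) = card (F 1)" for i
          by (simp only: card_F)
        show "a < b" if "a \<in> F i" "b \<in> F (Suc i)" for i a b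
          using F_less[OF that] by simp
      qed (simp add: P_def)
      have "N \<le> a" if a: "a \<in> F 1" for a
      proof -
        obtain l where l: "N + 1 \<le> l" "a = elM M l"
          using a by (auto simp: F_def)
        then show ?thesis
          using elM_ge[of l] by simp
      qed
      moreover have "finite (F 1)" "F 1 \<noteq> {}"
        using N by (auto simp: F_def)
      ultimately show "card (F 1) \<le> Min (F 1)"
        unfolding card_F by simp
    qed
    have PQ: "P \<subseteq> Q N"
    proof
      fix t assume t: "t \<in> P"
      then have t': "finite t" "card t = kk"
        by (auto simp: P_def ksubsets_def)
      have "F i \<subseteq> restr M ((kk + 1) * N)" if "i \<in> {1..kk}" for i
      proof -
        have "(i + 1) * N \<le> (kk + 1) * N"
          using that by (intro mult_right_mono) auto
        then show ?thesis
          unfolding F_def restr_def by (intro image_mono) auto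
      qed
      then have "el t ` {1..card t} \<subseteq> restr M ((kk + 1) * N)"
        using t t'(2) by (fastforce simp: P_def)
      then show "t \<in> Q N"
        using t' el_image_eq[OF t'(1)] by (simp add: Q_def ksubsets_def)
    qed
    \<comment> \<open>Choosing one element from each block gives different members of
      \<open>P\<close> for different choices: the blocks are ordered, so \<open>el\<close> recovers
      the choice from its set of values.\<close>
    have "N ^ kk \<le> card P"
    proof -
      have mono: "strict_mono_on {1..kk} g" if "g \<in> (\<Pi>\<^sub>E i\<in>{1..kk}. F i)" for g
        by (rule strict_mono_onI) (use that F_less in \<open>blast dest: PiE_mem\<close>)
      have el_g: "el (g ` {1..kk}) i = g i" if "g \<in> (\<Pi>\<^sub>E i\<in>{1..kk}. F i)" "i \<in> {1..kk}" for g i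
        using el_image[OF mono[OF that(1)]] that(2) by simp
      have "inj_on (\<lambda>g. g ` {1..kk}) (\<Pi>\<^sub>E i\<in>{1..kk}. F i)"
      proof (rule inj_onI)
        fix g h assume *: "g \<in> (\<Pi>\<^sub>E i\<in>{1..kk}. F i)" "h \<in> (\<Pi>\<^sub>E i\<in>{1..kk}. F i)" "g ` {1..kk} = h ` {1..kk}"
        show "g = h"
          by (rule PiE_ext[OF *(1,2)]) (metis *(1-3) el_g)
      qed
      moreover have "(\<lambda>g. g ` {1..kk}) ` (\<Pi>\<^sub>E i\<in>{1..kk}. F i) \<subseteq> P"
      proof (rule image_subsetI)
        fix g assume g: "g \<in> (\<Pi>\<^sub>E i\<in>{1..kk}. F i)"
        have "g i \<in> NN" if "i \<in> {1..kk}" for i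
          using PiE_mem[OF g that] elM_M M(1) by (auto simp: F_def)
        moreover have "card (g ` {1..kk}) = kk"
          using card_image[OF strict_mono_on_imp_inj_on[OF mono[OF g]]] by simp
        ultimately show "g ` {1..kk} \<in> P"
          using PiE_mem[OF g] el_g[OF g] by (auto simp: P_def ksubsets_def)
      qed
      moreover have "finite P"
        using PQ Q(1) finite_subset by blast
      ultimately have "card (\<Pi>\<^sub>E i\<in>{1..kk}. F i) \<le> card P"
        by (rule card_inj_on_le)
      then show ?thesis
        by (simp add: card_PiE card_F)
    qed
    have "real N ^ kk / real ((kk + 1) * N) ^ kk \<le> real N ^ kk / real ((kk + 1) * N choose kk)"
    proof (rule divide_left_mono)
      show "real ((kk + 1) * N choose kk) \<le> real ((kk + 1) * N) ^ kk"
        using binomial_le_pow[OF le[OF N]] by (metis of_nat_le_iff of_nat_power)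
      show "0 < real ((kk + 1) * N) ^ kk * real ((kk + 1) * N choose kk)"
      proof (intro mult_pos_pos zero_less_power)
        show "0 < real ((kk + 1) * N)"
          using N by (simp only: of_nat_0_less_iff) simp
        show "0 < real ((kk + 1) * N choose kk)"
          using le[OF N] by simp
      qed
    qed simp
    also have "\<dots> \<le> real (card P) / real ((kk + 1) * N choose kk)"
      using \<open>N ^ kk \<le> card P\<close> by (intro divide_right_mono) (simp_all flip: of_nat_power)
    also have "\<dots> = (\<Sum>t\<in>P. \<bar>v N t\<bar>)"
      using PQ by (simp add: v_def subset_iff)
    also have "\<dots> \<le> norm (avg N)"
      using Xnorm_ge_family[OF v(1) P] norm_j[OF v(1)] by (simp add: v(2))
    finally have "real N ^ kk / real ((kk + 1) * N) ^ kk \<le> norm (avg N)" .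
    moreover have "real N ^ kk / real ((kk + 1) * N) ^ kk = 1 / real (kk + 1) ^ kk"
      unfolding of_nat_mult power_mult_distrib using N by simp
    ultimately show ?thesis
      by simp
  qed
  then have "\<forall>\<^sub>F N in sequentially. 1 / real (kk + 1) ^ kk \<le> norm (avg N)"
    by (rule eventually_mono[OF eventually_ge_at_top[of 1]])
  then have "1 / real (kk + 1) ^ kk \<le> norm x0"
    by (rule tendsto_lowerbound[OF tendsto_norm[OF avg]]) simp
  moreover have "0 < 1 / real (kk + 1) ^ kk"
    by (intro divide_pos_pos zero_less_power) auto
  ultimately have "0 < norm x0"
    by (rule less_le_trans[rotated])
  then show False
    using \<open>x0 = 0\<close> by simp
qed

end

theorem mainTheorem19:
  fixes k :: nat and j :: "(nat set \<Rightarrow> real) \<Rightarrow> 'a::banach"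
  assumes "k \<ge> 1"
    and "is_completion_map (k + 1) j"
  shows
   "(unconditional_basis (ksubsets NN (k + 1)) (\<lambda>s. j (unitvec s)) \<and>
     (\<exists>M. generates_sm (k + 1) (\<lambda>s. j (unitvec s)) M (\<lambda>a m. \<Sum>i=1..m. \<bar>a i\<bar>))) \<and>
    reflexive TYPE('a) \<and>
    (\<forall>(x :: nat set \<Rightarrow> 'a) M (nrm :: 'e::real_vector \<Rightarrow> real) e.
        k_spreading_model k x M nrm e \<longrightarrow> \<not> equiv_l1_basis nrm e) \<and>
    (\<forall>M x0. M \<subseteq> NN \<and> infinite M \<longrightarrow> \<not> cesaro_summable (k + 1) (\<lambda>s. j (unitvec s)) M x0)"
proof -
  interpret completion "k + 1" j
    by unfold_locales (use assms in auto)
  show ?thesis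
  proof (intro conjI allI impI)
    show "unconditional_basis (ksubsets NN (k + 1)) (\<lambda>s. j (unitvec s))"
      by (rule unconditional_basis_e)
    show "\<exists>M. generates_sm (k + 1) (\<lambda>s. j (unitvec s)) M (\<lambda>a m. \<Sum>i=1..m. \<bar>a i\<bar>)"
      by (rule exI, rule generates_sm_e)
    show "reflexive TYPE('a)"
      using assms(1) by (intro reflexive_completion) simp
    show "\<not> equiv_l1_basis nrm b" if "k_spreading_model k x M nrm b"
      for x :: "nat set \<Rightarrow> 'a" and M and nrm :: "'e \<Rightarrow> real" and b
      using assms(1) that by (intro no_l1_spreading_model) auto
    show "\<not> cesaro_summable (k + 1) (\<lambda>s. j (unitvec s)) M x0" if "M \<subseteq> NN \<and> infinite M" for M x0
      using that by (intro not_cesaro_summable) auto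
  qed
qed

end
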